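(* For every $\lambda$-ring $(A,\lambda_A)$, the canonical map $\Omega_A^1 \to \Omega_{(A,\lambda_A)}^1$, i.e. the unique $A$-linear map from the module of (absolute) Kähler differentials of the ring $A$ that carries the universal ring derivation $A \to \Omega^1_A$ to the underlying ring derivation of the universal $\lambda$-ring derivation $d \colon (A,\lambda_A) \to (\Omega_{(A,\lambda_A)}^1,\lambda_{\Omega_{(A,\lambda_A)}^1})$, is an isomorphism of $A$-modules.
   Context: All rings are commutative and unital; $\mathbb{N}$ is the set of positive integers. Big Witt vectors: $\mathbb{W}(A)$ is the set $A^{\mathbb{N}}$ with the unique ring structure, functorial in $A$, for which all ghost maps $w_n \colon \mathbb{W}(A) \to A$, $w_n(a) = \sum_{e \mid n} e a_e^{n/e}$, are natural ring homomorphisms. The $a_n$ are the Witt components of $a$. $F_n \colon \mathbb{W}(A)\to\mathbb{W}(A)$ is the unique natural ring homomorphism with $w_e \circ F_n = w_{ne}$ for all $e$. $\Delta=\Delta_A \colon \mathbb{W}(A) \to \mathbb{W}(\mathbb{W}(A))$ is the unique natural ring homomorphism with $w_n \circ \Delta = F_n$ for all $n$, and $\epsilon_A = w_1 \colon \mathbb{W}(A) \to A$. A $\lambda$-ring is a pair $(A,\lambda_A)$ of a ring $A$ and a ring homomorphism $\lambda_A \colon A \to \mathbb{W}(A)$ with $\epsilon_A \circ \lambda_A = \mathrm{id}_A$ and $\mathbb{W}(\lambda_A)\circ\lambda_A = \Delta_A \circ \lambda_A$. Let $\lambda_{A,n}\colon A \to A$ be its $n$th Witt component and $\psi_{A,n}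 = w_n\circ\lambda_A \colon A \to A$ the $n$th Adams operation, so $\psi_{A,n}(a) = \sum_{e\mid n} e\lambda_{A,e}(a)^{n/e}$. An $(A,\lambda_A)$-module is a pair $(M,\lambda_M)$ of an $A$-module $M$ and a family of additive maps $\lambda_{M,n}\colon M \to M$ ($n \in \mathbb{N}$) with $\lambda_{M,n}(ax) = \psi_{A,n}(a)\lambda_{M,n}(x)$, $\lambda_{M,1}=\mathrm{id}_M$, and $\lambda_{M,m}\lambda_{M,n} = \lambda_{M,mn}$. Morphisms are the $A$-linear maps commuting with all $\lambda_{M,n}$. A derivation $D\colon (A,\lambda_A)\to(M,\lambda_M)$ is a map $D \colon A \to M$ with $D(a+b)=D(a)+D(b)$, $D(ab)=bD(a)+aD(b)$, and $\lambda_{M,n}(D(a)) = \sum_{e\mid n}\lambda_{A,e}(a)^{(n/e)-1}D(\lambda_{A,e}(a))$ for all $a,b\in A$ and $n \in \mathbb{N}$. There is a universal such derivation $d\colon (A,\lambda_A)\to(\Omega^1_{(A,\lambda_A)},\lambda_{\Omega^1_{(A,\lambda_A)}})$: every derivation $D$ into an $(A,\lambda_A)$-module factors as $f\circ d$ for a unique morphism $f$ of $(A,\lambda_A)$-modules. *)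

theory Defs
  imports
    "HOL-Library.Poly_Mapping"
    "HOL-Algebra.Module"
    "HOL-Algebra.Algebraic_Closure_Type"
begin

section \<open>Integer polynomials in arbitrarily many variables\<close>

type_synonym 'v zpoly = "('v \<Rightarrow>\<^sub>0 nat) \<Rightarrow>\<^sub>0 int"

definition zpoly_ring :: "'v zpoly ring" where
  "zpoly_ring = ring_of_type_algebra"

definition zpoly_var :: "'v \<Rightarrow> 'v zpoly" where
  "zpoly_var v = Poly_Mapping.single (Poly_Mapping.single v 1) 1"

definition zpoly_eval :: "('a, 'b) ring_scheme \<Rightarrow> ('v \<Rightarrow> 'a) \<Rightarrow> 'v zpoly \<Rightarrow> 'a" where
  "zpoly_eval A x p =
     (\<Oplus>\<^bsub>A\<^esub>m\<in>Poly_Mapping.keys p. [Poly_Mapping.lookup p m] \<cdot>\<^bsub>A\<^esub>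
        (\<Otimes>\<^bsub>A\<^esub>v\<in>Poly_Mapping.keys m. x v [^]\<^bsub>A\<^esub> Poly_Mapping.lookup m v))"


section \<open>Big Witt vectors\<close>

text \<open>
  A Witt vector over \<^term>\<open>A\<close> is a family indexed by the positive integers, i.e. an element of
  \<^term>\<open>{0<..} \<rightarrow>\<^sub>E carrier A\<close>; its value at the index 0 is the dummy \<^term>\<open>undefined\<close>.
\<close>

definition ghost :: "('a, 'b) ring_scheme \<Rightarrow> nat \<Rightarrow> (nat \<Rightarrow> 'a) \<Rightarrow> 'a" where
  "ghost A n a = (\<Oplus>\<^bsub>A\<^esub>e\<in>{e. e dvd n}. [e] \<cdot>\<^bsub>A\<^esub> (a e [^]\<^bsub>A\<^esub> (n div e)))"

text \<open>
  A natural operation on Witt vectors is given by universal integer polynomials, namely by its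
  value on the tautological Witt vectors over a polynomial ring over the integers (by naturality, every other
  value is obtained from this one by evaluating the polynomials).  That ring is
  torsion free, so a Witt vector over it is determined by its ghost components; the ghost
  components prescribed below are attained by Dwork's lemma.
\<close>

definition witt_of_ghost :: "('a, 'b) ring_scheme \<Rightarrow> (nat \<Rightarrow> 'a) \<Rightarrow> nat \<Rightarrow> 'a" where
  "witt_of_ghost A g = (THE c. c \<in> {0<..} \<rightarrow>\<^sub>E carrier A \<and> (\<forall>n>0. ghost A n c = g n))"

definition add_poly :: "nat \<Rightarrow> (nat + nat) zpoly" where
  "add_poly = witt_of_ghost zpoly_ring
     (\<lambda>n. ghost zpoly_ring n (\<lambda>k. zpoly_var (Inl k))
            \<oplus>\<^bsub>zpoly_ring\<^esub> ghost zpoly_ring n (\<lambda>k. zpoly_var (Inr k)))"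

definition mult_poly :: "nat \<Rightarrow> (nat + nat) zpoly" where
  "mult_poly = witt_of_ghost zpoly_ring
     (\<lambda>n. ghost zpoly_ring n (\<lambda>k. zpoly_var (Inl k))
            \<otimes>\<^bsub>zpoly_ring\<^esub> ghost zpoly_ring n (\<lambda>k. zpoly_var (Inr k)))"

definition witt_ring :: "('a, 'b) ring_scheme \<Rightarrow> (nat \<Rightarrow> 'a) ring" where
  "witt_ring A =
     \<lparr>carrier = {0<..} \<rightarrow>\<^sub>E carrier A,
      monoid.mult = (\<lambda>a b. \<lambda>n\<in>{0<..}. zpoly_eval A (case_sum a b) (mult_poly n)),
      one = (\<lambda>n\<in>{0<..}. if n = 1 then \<one>\<^bsub>A\<^esub> else \<zero>\<^bsub>A\<^esub>),
      zero = (\<lambda>n\<in>{0<..}. \<zero>\<^bsub>A\<^esub>),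
      add = (\<lambda>a b. \<lambda>n\<in>{0<..}. zpoly_eval A (case_sum a b) (add_poly n))\<rparr>"

definition witt_map :: "('a \<Rightarrow> 'c) \<Rightarrow> (nat \<Rightarrow> 'a) \<Rightarrow> nat \<Rightarrow> 'c" where
  "witt_map f a = (\<lambda>n\<in>{0<..}. f (a n))"

definition frobenius_poly :: "nat \<Rightarrow> nat \<Rightarrow> nat zpoly" where
  "frobenius_poly n = witt_of_ghost zpoly_ring (\<lambda>e. ghost zpoly_ring (n * e) zpoly_var)"

definition frobenius :: "('a, 'b) ring_scheme \<Rightarrow> nat \<Rightarrow> (nat \<Rightarrow> 'a) \<Rightarrow> nat \<Rightarrow> 'a" where
  "frobenius A n a = (\<lambda>k\<in>{0<..}. zpoly_eval A a (frobenius_poly n k))"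

text \<open>
  The value of the comultiplication on the tautological Witt vector: the Witt vector over the ring
  of Witt vectors whose \<open>n\<close>-th ghost component is the \<open>n\<close>-th Frobenius.
\<close>

definition comult_poly :: "nat \<Rightarrow> nat \<Rightarrow> nat zpoly" where
  "comult_poly = witt_of_ghost (witt_ring zpoly_ring)
     (\<lambda>n. frobenius zpoly_ring n (\<lambda>k\<in>{0<..}. zpoly_var k))"

definition comult :: "('a, 'b) ring_scheme \<Rightarrow> (nat \<Rightarrow> 'a) \<Rightarrow> nat \<Rightarrow> nat \<Rightarrow> 'a" where
  "comult A a = (\<lambda>e\<in>{0<..}. \<lambda>k\<in>{0<..}. zpoly_eval A a (comult_poly e k))"


section \<open>Lambda-rings, their modules and derivations\<close>

locale lambda_ring = cring A for A (structure) +
  fixes lam :: "'a \<Rightarrow> nat \<Rightarrow> 'a"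
  assumes lam_hom: "lam \<in> ring_hom A (witt_ring A)"
    and counit: "a \<in> carrier A \<Longrightarrow> ghost A 1 (lam a) = a"
    and coassoc: "a \<in> carrier A \<Longrightarrow> witt_map lam (lam a) = comult A (lam a)"

definition adams :: "('a, 'b) ring_scheme \<Rightarrow> ('a \<Rightarrow> nat \<Rightarrow> 'a) \<Rightarrow> nat \<Rightarrow> 'a \<Rightarrow> 'a" where
  "adams A lam n a = ghost A n (lam a)"

locale lambda_module = lambda_ring A lam + module A M
  for A (structure) and lam and M (structure) +
  fixes lamM :: "nat \<Rightarrow> 'c \<Rightarrow> 'c"
  assumes lamM_closed: "\<lbrakk>n > 0; x \<in> carrier M\<rbrakk> \<Longrightarrow> lamM n x \<in> carrier M"
    and lamM_add: "\<lbrakk>n > 0; x \<in> carrier M; y \<in> carrier M\<rbrakk> \<Longrightarrow>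
           lamM n (x \<oplus>\<^bsub>M\<^esub> y) = lamM n x \<oplus>\<^bsub>M\<^esub> lamM n y"
    and lamM_smult: "\<lbrakk>n > 0; a \<in> carrier A; x \<in> carrier M\<rbrakk> \<Longrightarrow>
           lamM n (a \<odot>\<^bsub>M\<^esub> x) = adams A lam n a \<odot>\<^bsub>M\<^esub> lamM n x"
    and lamM_one: "x \<in> carrier M \<Longrightarrow> lamM 1 x = x"
    and lamM_lamM: "\<lbrakk>m > 0; n > 0; x \<in> carrier M\<rbrakk> \<Longrightarrow> lamM m (lamM n x) = lamM (m * n) x"

text \<open>
  Linear maps are taken to be extensional functions on the carrier, so that uniqueness of a linear
  map means equality of functions.
\<close>

definition mod_hom ::
  "('a, 'b) ring_scheme \<Rightarrow> ('a, 'c, 'd) module_scheme \<Rightarrow> ('a, 'e, 'f) module_scheme \<Rightarrow> ('c \<Rightarrow> 'e) set"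
where
  "mod_hom A M N =
     {f \<in> carrier M \<rightarrow>\<^sub>E carrier N.
        (\<forall>x\<in>carrier M. \<forall>y\<in>carrier M. f (x \<oplus>\<^bsub>M\<^esub> y) = f x \<oplus>\<^bsub>N\<^esub> f y) \<and>
        (\<forall>a\<in>carrier A. \<forall>x\<in>carrier M. f (a \<odot>\<^bsub>M\<^esub> x) = a \<odot>\<^bsub>N\<^esub> f x)}"

definition mod_iso ::
  "('a, 'b) ring_scheme \<Rightarrow> ('a, 'c, 'd) module_scheme \<Rightarrow> ('a, 'e, 'f) module_scheme \<Rightarrow> ('c \<Rightarrow> 'e) set"
where
  "mod_iso A M N = {f \<in> mod_hom A M N. bij_betw f (carrier M) (carrier N)}"

definition lambda_mod_hom ::
  "('a, 'b) ring_scheme \<Rightarrow> ('a, 'c, 'd) module_scheme \<Rightarrow> (nat \<Rightarrow> 'c \<Rightarrow> 'c) \<Rightarrow>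
   ('a, 'e, 'f) module_scheme \<Rightarrow> (nat \<Rightarrow> 'e \<Rightarrow> 'e) \<Rightarrow> ('c \<Rightarrow> 'e) set"
where
  "lambda_mod_hom A M lamM N lamN =
     {f \<in> mod_hom A M N. \<forall>n>0. \<forall>x\<in>carrier M. f (lamM n x) = lamN n (f x)}"

locale derivation = module A M for A (structure) and M (structure) +
  fixes D :: "'a \<Rightarrow> 'c"
  assumes D_closed: "a \<in> carrier A \<Longrightarrow> D a \<in> carrier M"
    and D_add: "\<lbrakk>a \<in> carrier A; b \<in> carrier A\<rbrakk> \<Longrightarrow> D (a \<oplus> b) = D a \<oplus>\<^bsub>M\<^esub> D b"
    and D_mult: "\<lbrakk>a \<in> carrier A; b \<in> carrier A\<rbrakk> \<Longrightarrow>
           D (a \<otimes> b) = b \<odot>\<^bsub>M\<^esub> D a \<oplus>\<^bsub>M\<^esub> a \<odot>\<^bsub>M\<^esub> D b"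

locale lambda_derivation = lambda_module A lam M lamM + derivation A M D
  for A (structure) and lam and M (structure) and lamM and D +
  assumes lamM_D: "\<lbrakk>n > 0; a \<in> carrier A\<rbrakk> \<Longrightarrow>
     lamM n (D a) =
       (\<Oplus>\<^bsub>M\<^esub>e\<in>{e. e dvd n}. (lam a e [^] (n div e - 1)) \<odot>\<^bsub>M\<^esub> D (lam a e))"


section \<open>Universal derivations\<close>

text \<open>
  The modules against which universality is tested are those whose elements have a given type
  \<open>'t\<close> (with arbitrary subsets of \<open>'t\<close> as carriers): HOL cannot quantify over all types
  inside a formula.  An object that is universal against all modules satisfies the predicates
  below for every \<open>'t\<close>.
\<close>

definition universal_derivation ::
  "'t itself \<Rightarrow> ('a, 'b) ring_scheme \<Rightarrow> ('a, 'c) module \<Rightarrow> ('a \<Rightarrow> 'c) \<Rightarrow> bool"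
where
  "universal_derivation T A \<Omega> d \<longleftrightarrow>
     derivation A \<Omega> d \<and>
     (\<forall>(M :: ('a, 't) module) D. derivation A M D \<longrightarrow>
        (\<exists>!f. f \<in> mod_hom A \<Omega> M \<and> (\<forall>a\<in>carrier A. f (d a) = D a)))"

definition universal_lambda_derivation ::
  "'t itself \<Rightarrow> ('a, 'b) ring_scheme \<Rightarrow> ('a \<Rightarrow> nat \<Rightarrow> 'a) \<Rightarrow>
   ('a, 'c) module \<Rightarrow> (nat \<Rightarrow> 'c \<Rightarrow> 'c) \<Rightarrow> ('a \<Rightarrow> 'c) \<Rightarrow> bool"
where
  "universal_lambda_derivation T A lam \<Omega> lam\<Omega> d \<longleftrightarrow>
     lambda_derivation A lam \<Omega> lam\<Omega> d \<and>
     (\<forall>(M :: ('a, 't) module) lamM D. lambda_derivation A lam M lamM D \<longrightarrow>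
        (\<exists>!f. f \<in> lambda_mod_hom A \<Omega> lam\<Omega> M lamM \<and> (\<forall>a\<in>carrier A. f (d a) = D a)))"

end

theory Submission
  imports Defs
begin

text \<open>
  The operations on the Kaehler differentials must satisfy
  \<open>\<lambda>\<^sub>n (a db) = \<psi>\<^sub>n(a) D\<^sub>n(b)\<close> with \<open>D\<^sub>n(b) = \<Sum>\<^bsub>e | n\<^esub> \<lambda>\<^sub>e(b)^(n/e - 1) d\<lambda>\<^sub>e(b)\<close>.
  They exist if \<open>D\<^sub>n\<close> is a derivation along \<open>\<psi>\<^sub>n\<close>, and they compose correctly if the values
  \<open>\<lambda>\<^sub>m (D\<^sub>n b)\<close> and \<open>D\<^sub>m\<^sub>n b\<close> agree.  Formally \<open>n D\<^sub>n = d \<psi>\<^sub>n\<close>, so both facts would follow from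
  the additivity, multiplicativity and composition laws of the ghost maps if one could divide by
  \<open>n\<close>.  The differentials of \<open>A\<close> can have torsion, but the universal cases live over integer
  polynomial rings, where the differentials are free on the variables: there one differentiates
  the polynomial identities, divides by \<open>n\<close>, and specializes.  The integral polynomials come from
  Dwork's lemma; for the comultiplication, the ghost components of its \<open>e\<close>-th component are the
  \<open>e\<close>-th components of the Frobenii, and these satisfy Dwork's congruences because congruences
  between ghost components descend to Witt components.  With this structure \<open>d\<close> is a
  \<open>\<lambda>\<close>-derivation, and the two universal properties give mutually inverse maps.
\<close>

section \<open>Evaluation of integer polynomials\<close>

lemma ring_of_type_algebra_simps:
  "carrier (ring_of_type_algebra :: 'r::comm_ring_1 ring) = UNIV"
  "x \<otimes>\<^bsub>ring_of_type_algebra\<^esub> y = x * (y :: 'r)"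
  "x \<oplus>\<^bsub>ring_of_type_algebra\<^esub> y = x + (y :: 'r)"
  "\<one>\<^bsub>ring_of_type_algebra\<^esub> = (1 :: 'r)"
  "\<zero>\<^bsub>ring_of_type_algebra\<^esub> = (0 :: 'r)"
  by (simp_all add: ring_of_type_algebra_def)

lemma nat_pow_type_algebra:
  "x [^]\<^bsub>ring_of_type_algebra\<^esub> (n::nat) = (x :: 'r::comm_ring_1) ^ n"
proof -
  interpret cring "ring_of_type_algebra :: 'r ring" by (rule cring_from_type_algebra)
  show ?thesis by (induction n) (simp_all add: ring_of_type_algebra_simps mult.commute)
qed

lemma add_pow_type_algebra:
  "[n] \<cdot>\<^bsub>ring_of_type_algebra\<^esub> (x :: 'r::comm_ring_1) = of_nat n * x"
proof -
  interpret cring "ring_of_type_algebra :: 'r ring" by (rule cring_from_type_algebra)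
  show ?thesis
    by (induction n) (simp_all add: ring_of_type_algebra_simps algebra_simps add_pow_def)
qed

lemma finsum_type_algebra:
  "finite I \<Longrightarrow> finsum ring_of_type_algebra f I = (\<Sum>i\<in>I. f i :: 'r::comm_ring_1)"
proof -
  interpret cring "ring_of_type_algebra :: 'r ring" by (rule cring_from_type_algebra)
  show "finite I \<Longrightarrow> ?thesis"
    by (induction rule: finite_induct) (simp_all add: ring_of_type_algebra_simps)
qed

lemmas type_algebra_simps =
  ring_of_type_algebra_simps nat_pow_type_algebra add_pow_type_algebra finsum_type_algebra

section \<open>Variables occurring in a polynomial\<close>

text \<open>A Witt vector has a dummy value at index 0, so it can be substituted only into
  polynomials whose variables have positive index. These sets record that, and they supply the
  finite sets of variables over which differentials are summed.\<close>

definition zvars :: "'v zpoly \<Rightarrow> 'v set" where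
  "zvars p = (\<Union>m\<in>Poly_Mapping.keys p. Poly_Mapping.keys m)"

lemma finite_zvars [simp]: "finite (zvars p)"
  by (simp add: zvars_def)

lemma zvars_zero [simp]: "zvars 0 = {}"
  by (simp add: zvars_def)

lemma zvars_one [simp]: "zvars 1 = {}"
  by (simp add: zvars_def)

lemma zvars_var [simp]: "zvars (zpoly_var v) = {v}"
  by (simp add: zvars_def zpoly_var_def)

lemma zvars_add: "zvars (p + q) \<subseteq> zvars p \<union> zvars q"
  using Poly_Mapping.keys_add[of p q] by (auto simp: zvars_def)

lemma zvars_uminus [simp]: "zvars (- p) = zvars p"
  by (simp add: zvars_def in_keys_iff set_eq_iff)

lemma zvars_diff: "zvars (p - q) \<subseteq> zvars p \<union> zvars q"
  using zvars_add[of p "- q"] by simp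

lemma zvars_mult: "zvars (p * q) \<subseteq> zvars p \<union> zvars q"
proof
  fix v assume "v \<in> zvars (p * q)"
  then obtain m where m: "m \<in> Poly_Mapping.keys (p * q)" "v \<in> Poly_Mapping.keys m"
    by (auto simp: zvars_def)
  then obtain a b where ab: "m = a + b" "a \<in> Poly_Mapping.keys p" "b \<in> Poly_Mapping.keys q"
    using Poly_Mapping.keys_mult[of p q] by blast
  with m(2) have "v \<in> Poly_Mapping.keys a \<or> v \<in> Poly_Mapping.keys b"
    using Poly_Mapping.keys_add[of a b] by blast
  with ab show "v \<in> zvars p \<union> zvars q" by (auto simp: zvars_def)
qed

lemma zvars_power: "zvars (p ^ n) \<subseteq> zvars p"
  using zvars_mult by (induction n) force+

lemma zvars_sum: "zvars (\<Sum>i\<in>I. f i) \<subseteq> (\<Union>i\<in>I. zvars (f i))"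
proof (induction I rule: infinite_finite_induct)
  case (insert i I)
  then show ?case using zvars_add[of "f i" "\<Sum>i\<in>I. f i"] by auto
qed auto

section \<open>Divisibility by integers\<close>

lemma lookup_of_nat_mult:
  "Poly_Mapping.lookup (of_nat n * p :: 'v zpoly) m = int n * Poly_Mapping.lookup p m"
proof -
  have "of_nat n * p = (\<Sum>i<n. p)" by simp
  then show ?thesis by (simp only: lookup_sum) simp
qed

text \<open>Torsion freeness, read off coefficients. It allows the universal identities to be
  divided by \<open>n\<close>, whereas \<open>A\<close> and its differentials may have
  torsion.\<close>

lemma of_nat_mult_zpoly_cancel:
  "n > 0 \<Longrightarrow> of_nat n * p = of_nat n * (q :: 'v zpoly) \<longleftrightarrow> p = q"
  by (auto simp: poly_mapping_eq_iff lookup_of_nat_mult fun_eq_iff)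

lemma of_nat_dvd_zpoly_iff:
  "of_nat n dvd (p :: 'v zpoly) \<longleftrightarrow> (\<forall>m. int n dvd Poly_Mapping.lookup p m)"
proof
  assume "\<forall>m. int n dvd Poly_Mapping.lookup p m"
  then have eq: "int n * (Poly_Mapping.lookup p m div int n) = Poly_Mapping.lookup p m" for m
    by simp
  \<comment> \<open>The coefficientwise quotients have finite support, so they form a
    polynomial.\<close>
  have "finite {m. Poly_Mapping.lookup p m div int n \<noteq> 0}"
    by (rule finite_subset[OF _ finite_lookup[of p]]) auto
  then have "of_nat n * Abs_poly_mapping (\<lambda>m. Poly_Mapping.lookup p m div int n) = p"
    by (intro poly_mapping_eqI) (simp add: lookup_of_nat_mult eq)
  then show "of_nat n dvd p" by (metis dvd_triv_left)
qed (auto simp: lookup_of_nat_mult)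

lemma zvars_of_nat_mult:
  assumes "n > 0"
  shows "zvars (of_nat n * p) = zvars p"
proof -
  have "Poly_Mapping.keys (of_nat n * p) = Poly_Mapping.keys p"
    using assms by (auto simp: in_keys_iff lookup_of_nat_mult)
  then show ?thesis by (simp add: zvars_def)
qed

section \<open>Induction over polynomials\<close>

lemma poly_mapping_induct_single [case_names zero add]:
  assumes "P 0"
    and "\<And>k v p. \<lbrakk>v \<noteq> 0; k \<notin> Poly_Mapping.keys p;
      Poly_Mapping.keys (Poly_Mapping.single k v + p) = insert k (Poly_Mapping.keys p); P p\<rbrakk>
       \<Longrightarrow> P (Poly_Mapping.single k v + p)"
  shows "P (p :: 'k \<Rightarrow>\<^sub>0 'r::comm_monoid_add)"
proof (induction p rule: Poly_Mapping.update_induct)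
  case const then show ?case using assms(1) by simp
next
  case (update f a b)
  have "Poly_Mapping.update a b f = Poly_Mapping.single a b + f"
    using update(1)
    by (intro poly_mapping_eqI)
      (auto simp: lookup_update lookup_add lookup_single in_keys_iff when_def)
  with update assms(2)[of b a f] show ?case by (metis keys_update)
qed

text \<open>The variables generate the polynomials as a ring. The set \<open>V\<close> is carried
  along so that the variable case knows \<open>v \<in> V\<close>, which the chain rule
  \<open>D_ev\<close> uses to find its summand.\<close>

lemma zpoly_induct [consumes 1, case_names one var add uminus mult]:
  assumes "zvars p \<subseteq> V"
    and one: "P 1" and var: "\<And>v. v \<in> V \<Longrightarrow> P (zpoly_var v)"
    and add: "\<And>p q. \<lbrakk>zvars p \<subseteq> V; zvars q \<subseteq> V; P p; P q\<rbrakk> \<Longrightarrow> P (p + q)"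
    and uminus: "\<And>p. \<lbrakk>zvars p \<subseteq> V; P p\<rbrakk> \<Longrightarrow> P (- p)"
    and mult: "\<And>p q. \<lbrakk>zvars p \<subseteq> V; zvars q \<subseteq> V; P p; P q\<rbrakk> \<Longrightarrow> P (p * q)"
  shows "P (p :: 'v zpoly)"
proof -
  \<comment> \<open>With the bound on the variables built into \<open>Q\<close>, the side conditions
    of the closure hypotheses are available at every stage.\<close>
  define Q where "Q p \<longleftrightarrow> zvars p \<subseteq> V \<and> P p" for p
  have Q: "Q 1" "\<And>v. v \<in> V \<Longrightarrow> Q (zpoly_var v)" "\<And>p q. Q p \<Longrightarrow> Q q \<Longrightarrow> Q (p + q)"
    "\<And>p. Q p \<Longrightarrow> Q (- p)" "\<And>p q. Q p \<Longrightarrow> Q q \<Longrightarrow> Q (p * q)"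
    unfolding Q_def using one var add uminus mult zvars_add zvars_mult
    by (simp_all add: le_sup_iff order.trans[OF zvars_add] order.trans[OF zvars_mult])
  have Q0: "Q 0" using Q(3)[OF Q(1) Q(4)[OF Q(1)]] by simp
  have Q_nat: "Q (of_nat n)" for n by (induction n) (auto intro: Q Q0)
  have Q_int: "Q (of_int c)" for c by (cases c) (auto intro!: Q Q_nat simp del: of_nat_Suc)
  have Q_pow: "Q (p ^ n)" if "Q p" for p n using that by (induction n) (auto intro: Q)
  have single_pow: "Poly_Mapping.single (Poly_Mapping.single v n) 1 = zpoly_var v ^ n" for v :: 'v and n
  proof (induction n)
    case (Suc n)
    have "Poly_Mapping.single (Poly_Mapping.single v (Suc n)) (1::int)
        = Poly_Mapping.single (Poly_Mapping.single v 1 + Poly_Mapping.single v n) (1 * 1)"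
      by (simp flip: single_add)
    then show ?case by (simp only: mult_single[symmetric] Suc power_Suc zpoly_var_def)
  qed simp
  have Q_mon: "Poly_Mapping.keys m \<subseteq> V \<Longrightarrow> Q (Poly_Mapping.single m 1)" for m
  proof (induction m rule: poly_mapping_induct_single)
    case (add k n m)
    have "Poly_Mapping.single (Poly_Mapping.single k n + m) 1
        = zpoly_var k ^ n * (Poly_Mapping.single m 1 :: 'v zpoly)"
      by (simp add: mult_single flip: single_pow)
    with add show ?case by (auto intro!: Q Q_pow)
  qed (simp add: Q)
  have "zvars p \<subseteq> V \<Longrightarrow> Q p"
  proof (induction p rule: poly_mapping_induct_single)
    case (add m c p)
    have "Poly_Mapping.single m c = of_int c * (Poly_Mapping.single m 1 :: 'v zpoly)"
      by (simp add: mult_single flip: single_of_int)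
    with add show ?case by (auto simp: zvars_def intro!: Q Q_int Q_mon)
  qed (simp add: Q0)
  with assms(1) show ?thesis by (simp add: Q_def)
qed

section \<open>Evaluation as a ring homomorphism\<close>

locale zpoly_evaluation = cring A for A (structure) +
  fixes x :: "'v \<Rightarrow> 'a"
  assumes var_closed: "x v \<in> carrier A"
begin

abbreviation ev :: "'v zpoly \<Rightarrow> 'a" where "ev \<equiv> zpoly_eval A x"

definition mon :: "('v \<Rightarrow>\<^sub>0 nat) \<Rightarrow> 'a" where
  "mon m = (\<Otimes>v\<in>Poly_Mapping.keys m. x v [^] Poly_Mapping.lookup m v)"

lemma mon_closed [simp]: "mon m \<in> carrier A"
  unfolding mon_def by (intro finprod_closed) (auto simp: var_closed)

text \<open>Indices outside the keys have exponent 0 and contribute \<one>. Products over different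
  key sets can therefore be compared over their union.\<close>

lemma mon_superset:
  assumes "finite S" "Poly_Mapping.keys m \<subseteq> S"
  shows "mon m = (\<Otimes>v\<in>S. x v [^] Poly_Mapping.lookup m v)"
  unfolding mon_def
  by (rule finprod_mono_neutral_cong_left) (use assms in \<open>auto simp: in_keys_iff var_closed\<close>)

lemma mon_add: "mon (m + k) = mon m \<otimes> mon k"
proof -
  let ?S = "Poly_Mapping.keys m \<union> Poly_Mapping.keys k"
  have "mon (m + k) = (\<Otimes>v\<in>?S. x v [^] Poly_Mapping.lookup (m + k) v)"
    by (rule mon_superset) (simp_all add: Poly_Mapping.keys_add)
  also have "\<dots> = (\<Otimes>v\<in>?S. x v [^] Poly_Mapping.lookup m v \<otimes> x v [^] Poly_Mapping.lookup k v)"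
    by (intro finprod_cong') (auto simp: lookup_add nat_pow_mult var_closed)
  also have "\<dots> = mon m \<otimes> mon k"
    by (simp add: mon_superset[of ?S] var_closed finprod_multf Pi_iff)
  finally show ?thesis .
qed

lemma int_add_pow_closed [simp]: "y \<in> carrier A \<Longrightarrow> [(c::int)] \<cdot> y \<in> carrier A"
  using add.int_pow_closed by simp

lemma int_add_pow_zero [simp]: "[(0::int)] \<cdot> y = \<zero>"
  by (simp add: add_pow_def)

lemma ev_superset:
  assumes "finite S" "Poly_Mapping.keys p \<subseteq> S"
  shows "ev p = (\<Oplus>m\<in>S. [Poly_Mapping.lookup p m] \<cdot> mon m)"
  unfolding zpoly_eval_def mon_def[symmetric]
  by (rule add.finprod_mono_neutral_cong_left)
    (use assms in \<open>auto simp: in_keys_iff\<close>)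

lemma ev_closed [simp]: "ev p \<in> carrier A"
  by (subst ev_superset[OF finite_keys order.refl]) (auto intro!: finsum_closed)

lemma ev_single: "ev (Poly_Mapping.single m c) = [c] \<cdot> mon m"
  by (subst ev_superset[of "{m}"]) auto

lemma ev_add: "ev (p + q) = ev p \<oplus> ev q"
proof -
  let ?S = "Poly_Mapping.keys p \<union> Poly_Mapping.keys q"
  have "ev (p + q) = (\<Oplus>m\<in>?S. [Poly_Mapping.lookup (p + q) m] \<cdot> mon m)"
    by (rule ev_superset) (simp_all add: Poly_Mapping.keys_add)
  also have "\<dots> = (\<Oplus>m\<in>?S. [Poly_Mapping.lookup p m] \<cdot> mon m \<oplus> [Poly_Mapping.lookup q m] \<cdot> mon m)"
    using add.int_pow_mult by (intro finsum_cong') (auto simp: lookup_add)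
  also have "\<dots> = ev p \<oplus> ev q"
    by (simp add: ev_superset[of ?S] finsum_addf Pi_iff)
  finally show ?thesis .
qed

lemma ev_zero [simp]: "ev 0 = \<zero>"
  by (simp add: zpoly_eval_def)

lemma ev_mult_single:
  "ev (Poly_Mapping.single m c * Poly_Mapping.single k d)
   = ev (Poly_Mapping.single m c) \<otimes> ev (Poly_Mapping.single k d)"
proof -
  have "[c] \<cdot> mon m \<otimes> [d] \<cdot> mon k = [d] \<cdot> ([c] \<cdot> (mon m \<otimes> mon k))"
    by (simp add: add_pow_ldistr_int add_pow_rdistr_int)
  also have "\<dots> = [(c * d)] \<cdot> (mon m \<otimes> mon k)"
    using add.int_pow_pow[of "mon m \<otimes> mon k" d c] by (simp add: mult.commute)
  finally show ?thesis by (simp add: mult_single ev_single mon_add)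
qed

lemma ev_mult: "ev (p * q) = ev p \<otimes> ev q"
proof (induction p rule: poly_mapping_induct_single)
  case (add m c p)
  have "ev (Poly_Mapping.single m c * q) = ev (Poly_Mapping.single m c) \<otimes> ev q"
    by (induction q rule: poly_mapping_induct_single)
      (simp_all add: ev_mult_single ev_add distrib_left r_distr)
  with add show ?case by (simp add: ev_add distrib_right l_distr)
qed simp

lemma ev_one [simp]: "ev 1 = \<one>"
  using ev_single[of 0 1] by (simp add: mon_def)

lemma ev_var [simp]: "ev (zpoly_var v) = x v"
  by (simp add: zpoly_var_def ev_single mon_def var_closed)

lemma ev_uminus: "ev (- p) = \<ominus> ev p"
  using ev_add[of "- p" p] by (simp add: sum_zero_eq_neg)

lemma ev_power: "ev (p ^ n) = ev p [^] n"
  by (induction n) (simp_all add: ev_mult m_comm)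

lemma ev_of_nat_mult: "ev (of_nat n * p) = [n] \<cdot> ev p"
  by (induction n) (simp_all add: distrib_right ev_add a_comm)

lemma ev_sum: "ev (\<Sum>i\<in>I. f i) = (\<Oplus>i\<in>I. ev (f i))" if "finite I"
  using that by (induction rule: finite_induct) (simp_all add: ev_add)

text \<open>Only the variables of \<open>p\<close> matter, and elsewhere \<open>y\<close> may leave
  the carrier. This is how the dummy value of a Witt vector gets replaced by a ring element.\<close>

lemma ev_cong:
  assumes "\<And>v. v \<in> zvars p \<Longrightarrow> y v = x v"
  shows "zpoly_eval A y p = ev p"
proof -
  have "(\<Otimes>v\<in>Poly_Mapping.keys m. y v [^] Poly_Mapping.lookup m v) = mon m"
    if "m \<in> Poly_Mapping.keys p" for m
  proof -
    have "y v = x v" if "v \<in> Poly_Mapping.keys m" for v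
      using that \<open>m \<in> Poly_Mapping.keys p\<close> assms by (auto simp: zvars_def)
    then show ?thesis
      unfolding mon_def by (intro finprod_cong') (auto simp: var_closed)
  qed
  then show ?thesis
    unfolding zpoly_eval_def mon_def[symmetric]
    by (intro finsum_cong') auto
qed

end

section \<open>Dwork's lemma\<close>

definition ghost_comp :: "nat \<Rightarrow> (nat \<Rightarrow> 'r::comm_ring_1) \<Rightarrow> 'r" where
  "ghost_comp n c = (\<Sum>e | e dvd n. of_nat e * c e ^ (n div e))"

section \<open>Congruences modulo prime powers\<close>

lemma of_nat_dvd_of_nat: "m dvd n \<Longrightarrow> (of_nat m :: 'r::comm_semiring_1) dvd of_nat n"
  by (auto elim!: dvdE)

lemma diff_dvd_power_diff: "x - y dvd x ^ n - (y :: 'r::comm_ring_1) ^ n"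
  by (cases n) (auto simp: diff_power_eq_sum simp del: power_Suc)

text \<open>\<open>x ^ p - y ^ p\<close> is \<open>x - y\<close> times a sum of \<open>p\<close>
  products, each congruent to \<open>y ^ (p - 1)\<close> modulo \<open>p\<close>. That sum is
  divisible by \<open>p\<close>, which gains the extra factor.\<close>

lemma power_cong_prime_power_step:
  fixes x y :: "'r::comm_ring_1"
  assumes "of_nat (p ^ r) dvd x - y" "r > 0"
  shows "of_nat (p ^ Suc r) dvd x ^ p - y ^ p"
proof (cases p)
  case (Suc q)
  have p_dvd: "of_nat p dvd x - y"
    using assms by (metis dvd_power dvd_trans of_nat_power)
  have "(\<Sum>i<p. x ^ i * y ^ (q - i)) - of_nat p * y ^ q = (\<Sum>i<p. (x ^ i - y ^ i) * y ^ (q - i))"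
    using Suc by (simp add: left_diff_distrib sum_subtractf flip: power_add)
  also have "of_nat p dvd \<dots>"
    by (intro dvd_sum dvd_mult2) (rule dvd_trans[OF p_dvd diff_dvd_power_diff])
  finally have "of_nat p dvd (\<Sum>i<p. x ^ i * y ^ (q - i)) - of_nat p * y ^ q + of_nat p * y ^ q"
    by (rule dvd_add) simp
  then have "of_nat p dvd (\<Sum>i<p. x ^ i * y ^ (q - i))" by simp
  then have "of_nat p * of_nat (p ^ r) dvd (\<Sum>i<p. x ^ i * y ^ (q - i)) * (x - y)"
    using assms(1) by (rule mult_dvd_mono)
  also have "\<dots> = x ^ p - y ^ p"
    by (simp add: Suc diff_power_eq_sum mult.commute del: power_Suc)
  finally show ?thesis by simp
qed (use assms in simp)

text \<open>Each factor \<open>p\<close> of the exponent gains a factor \<open>p\<close> in the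
  modulus. The remaining exponent keeps the congruence because \<open>x - y\<close> divides
  \<open>x ^ m - y ^ m\<close>.\<close>

lemma power_cong_prime_power:
  fixes x y :: "'r::comm_ring_1"
  assumes "of_nat (p ^ r) dvd x - y" "r > 0"
  shows "of_nat (p ^ (r + multiplicity p n)) dvd x ^ n - y ^ n"
proof -
  have pow: "of_nat (p ^ (r + k)) dvd x ^ p ^ k - y ^ p ^ k" for k
  proof (induction k)
    case (Suc k)
    then show ?case
      using power_cong_prime_power_step[OF Suc] assms(2) by (simp add: power_mult[symmetric] mult.commute)
  qed (use assms in simp)
  obtain m where m: "n = p ^ multiplicity p n * m"
    using multiplicity_dvd[of p n] by (auto elim: dvdE)
  show ?thesis
    using dvd_trans[OF pow[of "multiplicity p n"] diff_dvd_power_diff[of _ _ m]]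
    by (simp flip: power_mult m)
qed

text \<open>In the summand at \<open>e\<close>, the coefficient contributes
  \<open>multiplicity p e\<close> factors of \<open>p\<close> and the exponent contributes
  \<open>multiplicity p (n div e)\<close> more. Together these are the
  \<open>multiplicity p n\<close> extra factors.\<close>

lemma ghost_comp_cong_prime_power:
  fixes c c' :: "nat \<Rightarrow> 'r::comm_ring_1"
  assumes "prime p" "n > 0" "r > 0"
    and "\<And>e. e dvd n \<Longrightarrow> of_nat (p ^ r) dvd c e - c' e"
  shows "of_nat (p ^ (r + multiplicity p n)) dvd ghost_comp n c - ghost_comp n c'"
proof -
  have "of_nat (p ^ (r + multiplicity p n)) dvd of_nat e * c e ^ (n div e) - of_nat e * c' e ^ (n div e)"
    if "e dvd n" for e
  proof -
    obtain k where k: "n = e * k" using \<open>e dvd n\<close> by auto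
    then have e: "e > 0" "k > 0" "n div e = k" using assms by auto
    then have "multiplicity p n = multiplicity p e + multiplicity p (n div e)"
      unfolding k using assms(1) by (subst prime_elem_multiplicity_mult_distrib) auto
    then have eq: "p ^ (r + multiplicity p n) = p ^ multiplicity p e * p ^ (r + multiplicity p (n div e))"
      by (simp add: power_add)
    have "of_nat (p ^ multiplicity p e) * of_nat (p ^ (r + multiplicity p (n div e)))
        dvd (of_nat e :: 'r) * (c e ^ (n div e) - c' e ^ (n div e))"
      using assms that by (intro mult_dvd_mono power_cong_prime_power of_nat_dvd_of_nat multiplicity_dvd)
    then show ?thesis by (simp only: eq of_nat_mult right_diff_distrib)
  qed
  then show ?thesis
    unfolding ghost_comp_def sum_subtractf[symmetric] by (intro dvd_sum) auto
qed

text \<open>On integer coefficients the \<open>p\<close>-part of \<open>n\<close> cancels, and the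
  remaining cofactor is prime to \<open>p\<close>.\<close>

lemma of_nat_prime_power_dvd_cancel:
  fixes z :: "'v zpoly"
  assumes "prime p" "n > 0" "of_nat (p ^ (r + multiplicity p n)) dvd of_nat n * z"
  shows "of_nat (p ^ r) dvd z"
proof -
  obtain m where m: "n = p ^ multiplicity p n * m" "\<not> p dvd m"
    using multiplicity_decompose'[of n p] assms by (auto simp: prime_nat_iff)
  have "int (p ^ r) dvd Poly_Mapping.lookup z k" for k
  proof -
    have "int (p ^ (r + multiplicity p n)) dvd int n * Poly_Mapping.lookup z k"
      using assms(3) by (simp only: of_nat_dvd_zpoly_iff lookup_of_nat_mult)
    also have "int n * Poly_Mapping.lookup z k
        = int (p ^ multiplicity p n) * (int m * Poly_Mapping.lookup z k)"
      by (subst m) simp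
    finally have "int (p ^ r) dvd int m * Poly_Mapping.lookup z k"
      using assms(1) by (simp add: power_add prime_gt_0_nat)
    moreover have "coprime (p ^ r) m"
      using m(2) assms(1) by (simp add: prime_imp_coprime)
    then have "coprime (int (p ^ r)) (int m)" by (simp only: coprime_int_iff)
    ultimately show ?thesis by (simp only: coprime_dvd_mult_right_iff)
  qed
  then show ?thesis by (simp only: of_nat_dvd_zpoly_iff) simp
qed

text \<open>The ghost equations are triangular: \<open>c n\<close> enters linearly with coefficient
  \<open>n\<close>, and everything else depends on proper divisors of \<open>n\<close>.\<close>

lemma ghost_comp_split:
  assumes "n > 0"
  shows "ghost_comp n c = of_nat n * c n + ghost_comp n (c(n := 0))"
proof -
  have "{e. e dvd n} = insert n {e. e dvd n \<and> e \<noteq> n}" by auto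
  moreover have "finite {e. e dvd n \<and> e \<noteq> n}"
    using assms by (auto intro: finite_subset[OF _ finite_divisors_nat[of n]])
  moreover have "(\<Sum>e | e dvd n \<and> e \<noteq> n. of_nat e * c e ^ (n div e))
     = (\<Sum>e | e dvd n \<and> e \<noteq> n. of_nat e * (c(n := 0)) e ^ (n div e))"
    by (intro sum.cong) auto
  ultimately show ?thesis
    using assms by (simp add: ghost_comp_def)
qed

lemma ghost_comp_cong:
  "(\<And>e. e dvd n \<Longrightarrow> c e = c' e) \<Longrightarrow> ghost_comp n c = ghost_comp n c'"
  unfolding ghost_comp_def by (intro sum.cong) auto

text \<open>Converse of \<open>ghost_comp_cong_prime_power\<close>, by induction along the
  triangular system. Once the lower components are congruent, the surplus
  \<open>multiplicity p n\<close> in the modulus pays for cancelling the coefficient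
  \<open>n\<close> of \<open>c n - c' n\<close>.\<close>

lemma cong_of_ghost_comp_cong:
  fixes c c' :: "nat \<Rightarrow> 'v zpoly"
  assumes p: "prime p" and r: "r > 0" and "n > 0"
    and gh: "\<And>n. n > 0 \<Longrightarrow> of_nat (p ^ (r + multiplicity p n)) dvd ghost_comp n c - ghost_comp n c'"
  shows "of_nat (p ^ r) dvd c n - c' n"
  using \<open>n > 0\<close>
proof (induction n rule: less_induct)
  case (less n)
  let ?P = "of_nat (p ^ (r + multiplicity p n)) :: 'v zpoly"
  have "?P dvd ghost_comp n (c(n := 0)) - ghost_comp n (c'(n := 0))"
  proof (rule ghost_comp_cong_prime_power[OF p less(2) r])
    fix e assume "e dvd n"
    then show "of_nat (p ^ r) dvd (c(n := 0)) e - (c'(n := 0)) e"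
      using less dvd_imp_le[of e n] by (cases "e = n") (auto intro: dvd_pos_nat)
  qed
  then have "?P dvd (ghost_comp n c - ghost_comp n c')
      - (ghost_comp n (c(n := 0)) - ghost_comp n (c'(n := 0)))"
    using gh[OF less(2)] by (rule dvd_diff[rotated])
  also have "\<dots> = of_nat n * (c n - c' n)"
    using ghost_comp_split[OF less(2), of c] ghost_comp_split[OF less(2), of c']
    by (simp add: algebra_simps)
  finally show ?case
    by (rule of_nat_prime_power_dvd_cancel[OF p less(2)])
qed

lemma ghost_comp_inject:
  fixes c c' :: "nat \<Rightarrow> 'v zpoly"
  assumes "\<And>n. n > 0 \<Longrightarrow> ghost_comp n c = ghost_comp n c'" "n > 0"
  shows "c n = c' n"
  using \<open>n > 0\<close>
proof (induction n rule: less_induct)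
  case (less n)
  have "ghost_comp n (c(n := 0)) = ghost_comp n (c'(n := 0))"
  proof (rule ghost_comp_cong)
    fix e assume "e dvd n"
    then show "(c(n := 0)) e = (c'(n := 0)) e"
      using less dvd_imp_le[of e n] by (cases "e = n") (auto intro: dvd_pos_nat)
  qed
  then show ?case
    using assms(1)[OF less(2)] ghost_comp_split[OF less(2), of c] ghost_comp_split[OF less(2), of c']
    by (simp add: of_nat_mult_zpoly_cancel less(2))
qed

lemma zpoly_ring_simps:
  "carrier (zpoly_ring :: 'v zpoly ring) = UNIV"
  "x \<otimes>\<^bsub>zpoly_ring\<^esub> y = x * (y :: 'v zpoly)"
  "x \<oplus>\<^bsub>zpoly_ring\<^esub> y = x + (y :: 'v zpoly)"
  "\<one>\<^bsub>zpoly_ring\<^esub> = (1 :: 'v zpoly)"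
  "\<zero>\<^bsub>zpoly_ring\<^esub> = (0 :: 'v zpoly)"
  "x [^]\<^bsub>zpoly_ring\<^esub> (n::nat) = (x :: 'v zpoly) ^ n"
  "[n] \<cdot>\<^bsub>zpoly_ring\<^esub> (x :: 'v zpoly) = of_nat n * x"
  "finite I \<Longrightarrow> finsum zpoly_ring f I = (\<Sum>i\<in>I. f i :: 'v zpoly)"
  by (simp_all add: zpoly_ring_def type_algebra_simps)

lemma cring_zpoly_ring: "cring zpoly_ring"
  unfolding zpoly_ring_def by (rule cring_from_type_algebra)

lemma zpoly_evaluation_zpoly_ring: "zpoly_evaluation zpoly_ring x"
  by (simp add: zpoly_evaluation_def cring_zpoly_ring zpoly_evaluation_axioms_def zpoly_ring_simps)

lemma ghost_zpoly_ring: "n > 0 \<Longrightarrow> ghost zpoly_ring n c = ghost_comp n c"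
  by (simp add: ghost_def ghost_comp_def zpoly_ring_simps)

section \<open>Lifts of Frobenius\<close>

definition frob_lift :: "nat \<Rightarrow> 'v zpoly \<Rightarrow> 'v zpoly" where
  "frob_lift p = zpoly_eval zpoly_ring (\<lambda>v. zpoly_var v ^ p)"

interpretation frob_lift: zpoly_evaluation zpoly_ring "\<lambda>v :: 'v. zpoly_var v ^ p"
  rewrites "zpoly_eval zpoly_ring (\<lambda>v. zpoly_var v ^ p) = frob_lift p"
  for p
  by (rule zpoly_evaluation_zpoly_ring) (simp add: frob_lift_def)

lemma frob_lift_of_nat: "frob_lift p (of_nat n) = of_nat n"
  using frob_lift.ev_of_nat_mult[of p n 1] by (simp add: zpoly_ring_simps)

lemmas frob_lift_simps =
  frob_lift.ev_add frob_lift.ev_mult frob_lift.ev_one frob_lift.ev_zero frob_lift.ev_var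
  frob_lift.ev_power frob_lift_of_nat

lemma frob_lift_ghost_comp: "n > 0 \<Longrightarrow> frob_lift p (ghost_comp n c) = ghost_comp n (\<lambda>e. frob_lift p (c e))"
  by (simp add: ghost_comp_def frob_lift.ev_sum frob_lift_simps zpoly_ring_simps)

lemma frob_lift_uminus: "frob_lift p (- x) = - frob_lift p x"
  using frob_lift.ev_add[of p x "- x"] by (simp add: zpoly_ring_simps eq_neg_iff_add_eq_0 add.commute)

lemma prime_dvd_add_power_diff:
  assumes "prime p"
  shows "of_nat p dvd (x + y) ^ p - x ^ p - (y :: 'r::comm_ring_1) ^ p"
proof -
  have p: "p > 0" using assms by (simp add: prime_gt_0_nat)
  have "{..p} = insert 0 (insert p {0<..<p})" using p by auto
  then have "(x + y) ^ p - x ^ p - y ^ p = (\<Sum>k\<in>{0<..<p}. of_nat (p choose k) * x ^ k * y ^ (p - k))"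
    using p by (simp add: binomial_ring)
  also have "of_nat p dvd \<dots>"
    using assms by (intro dvd_sum dvd_mult2 of_nat_dvd_of_nat dvd_choose_prime) auto
  finally show ?thesis .
qed

text \<open>The congruence holds at the variables and survives the ring operations, since the
  \<open>p\<close>-th power map is additive modulo \<open>p\<close> by the binomial theorem.\<close>

lemma frob_lift_cong_power:
  assumes p: "prime p"
  shows "of_nat p dvd frob_lift p f - f ^ p"
  using subset_UNIV[of "zvars f"]
proof (induction f rule: zpoly_induct)
  case (add f g)
  have "frob_lift p (f + g) - (f + g) ^ p
     = (frob_lift p f - f ^ p) + (frob_lift p g - g ^ p) - ((f + g) ^ p - f ^ p - g ^ p)"
    by (simp add: frob_lift_simps zpoly_ring_simps)
  with add prime_dvd_add_power_diff[OF p, of f g] show ?case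
    by (simp only: dvd_add dvd_diff)
next
  case (uminus f)
  \<comment> \<open>Additivity modulo \<open>p\<close>, applied to \<open>f + - f = 0\<close>, gives
    the sign rule without treating \<open>p = 2\<close> separately.\<close>
  have "frob_lift p (- f) - (- f) ^ p
     = (((f + - f) ^ p) - f ^ p - (- f) ^ p) - (frob_lift p f - f ^ p)"
    using p by (simp add: frob_lift_uminus prime_gt_0_nat zero_power)
  with uminus prime_dvd_add_power_diff[OF p, of f "- f"] show ?case
    by (simp only: dvd_diff)
next
  case (mult f g)
  have "frob_lift p (f * g) - (f * g) ^ p
     = (frob_lift p f - f ^ p) * frob_lift p g + f ^ p * (frob_lift p g - g ^ p)"
    by (simp add: frob_lift_simps zpoly_ring_simps power_mult_distrib algebra_simps)
  with mult show ?case by (simp only: dvd_add dvd_mult dvd_mult2)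
qed (simp_all add: frob_lift_simps zpoly_ring_simps)

section \<open>Dwork's congruences\<close>

definition dwork :: "(nat \<Rightarrow> 'v zpoly) \<Rightarrow> bool" where
  "dwork g \<longleftrightarrow> (\<forall>p n. prime p \<longrightarrow> n > 0 \<longrightarrow>
     of_nat (p ^ multiplicity p (p * n)) dvd g (p * n) - frob_lift p (g n))"

lemma dworkD:
  "\<lbrakk>dwork g; prime p; n > 0\<rbrakk> \<Longrightarrow>
     of_nat (p ^ multiplicity p (p * n)) dvd g (p * n) - frob_lift p (g n)"
  by (auto simp: dwork_def)

text \<open>Divisors of \<open>p * n\<close> not dividing \<open>n\<close> carry the full power of
  \<open>p\<close> in their coefficient. The others sum to the \<open>n\<close>-th ghost component
  of the powers \<open>c e ^ p\<close>, and replacing these by \<open>frob_lift p (c e)\<close>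
  changes it by a multiple of the same power.\<close>

lemma dwork_ghost_comp: "dwork (\<lambda>n. ghost_comp n c)"
  unfolding dwork_def
proof (intro allI impI)
  fix p n :: nat assume p: "prime p" and n: "n > 0"
  have p0: "p > 0" using p by (simp add: prime_gt_0_nat)
  let ?P = "of_nat (p ^ multiplicity p (p * n)) :: 'a zpoly"
  have mult: "multiplicity p (p * n) = 1 + multiplicity p n"
    using p n by (subst prime_elem_multiplicity_mult_distrib) auto
  have fin: "finite {e. e dvd p * n}" using p0 n by simp
  have "?P dvd of_nat e * c e ^ (p * n div e)" if e: "e dvd p * n" "\<not> e dvd n" for e
  proof -
    obtain k where k: "p * n = e * k" using e by auto
    \<comment> \<open>If \<open>p\<close> divided \<open>k\<close>, cancelling it in
      \<open>p * n = e * k\<close> would make \<open>e\<close> a divisor of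
      \<open>n\<close>.\<close>
    then have "\<not> p dvd k" using e(2) p0 by (auto elim!: dvdE simp: ac_simps)
    then have "multiplicity p k = 0" by (rule not_dvd_imp_multiplicity_0)
    moreover have "e \<noteq> 0" "k \<noteq> 0" using k p0 n by (metis mult_eq_0_iff not_gr_zero)+
    ultimately have "multiplicity p (p * n) = multiplicity p e"
      unfolding k using p by (subst prime_elem_multiplicity_mult_distrib) auto
    then show ?thesis
      by (intro dvd_mult2 of_nat_dvd_of_nat) (simp add: multiplicity_dvd)
  qed
  then have new: "?P dvd (\<Sum>e | e dvd p * n \<and> \<not> e dvd n. of_nat e * c e ^ (p * n div e))"
    by (intro dvd_sum) auto
  have "ghost_comp (p * n) c = (\<Sum>e | e dvd n. of_nat e * c e ^ (p * n div e))
       + (\<Sum>e | e dvd p * n \<and> \<not> e dvd n. of_nat e * c e ^ (p * n div e))"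
    unfolding ghost_comp_def using fin
    by (subst sum.union_disjoint[symmetric]) (auto intro!: sum.cong finite_subset[OF _ fin])
  also have "(\<Sum>e | e dvd n. of_nat e * c e ^ (p * n div e)) = ghost_comp n (\<lambda>e. c e ^ p)"
    unfolding ghost_comp_def
    by (intro sum.cong) (simp_all add: div_mult_swap flip: power_mult)
  finally have eq: "ghost_comp (p * n) c - frob_lift p (ghost_comp n c)
     = (\<Sum>e | e dvd p * n \<and> \<not> e dvd n. of_nat e * c e ^ (p * n div e))
        - (ghost_comp n (\<lambda>e. frob_lift p (c e)) - ghost_comp n (\<lambda>e. c e ^ p))"
    using n by (simp add: frob_lift_ghost_comp)
  have "?P dvd ghost_comp n (\<lambda>e. frob_lift p (c e)) - ghost_comp n (\<lambda>e. c e ^ p)"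
    unfolding mult by (rule ghost_comp_cong_prime_power) (use p n frob_lift_cong_power in auto)
  with new show "?P dvd ghost_comp (p * n) c - frob_lift p (ghost_comp n c)"
    unfolding eq by (rule dvd_diff)
qed

lemma of_nat_dvd_zpolyI:
  fixes z :: "'v zpoly"
  assumes "n > 0" "\<And>p. prime p \<Longrightarrow> p dvd n \<Longrightarrow> of_nat (p ^ multiplicity p n) dvd z"
  shows "of_nat n dvd z"
proof -
  have "int n dvd Poly_Mapping.lookup z m" for m
  proof (cases "Poly_Mapping.lookup z m = 0")
    case False
    have "n dvd nat \<bar>Poly_Mapping.lookup z m\<bar>"
    proof (rule multiplicity_le_imp_dvd)
      fix p :: nat assume p: "prime p"
      show "multiplicity p n \<le> multiplicity p (nat \<bar>Poly_Mapping.lookup z m\<bar>)"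
      proof (cases "p dvd n")
        case True
        then have "int (p ^ multiplicity p n) dvd Poly_Mapping.lookup z m"
          using assms(2)[OF p] by (simp only: of_nat_dvd_zpoly_iff)
        then have "p ^ multiplicity p n dvd nat \<bar>Poly_Mapping.lookup z m\<bar>"
          by (simp add: dvd_nat_abs_iff)
        then show ?thesis
          using False p by (intro multiplicity_geI) auto
      qed (simp add: not_dvd_imp_multiplicity_0)
    qed (use assms in auto)
    then show ?thesis by (simp add: dvd_nat_abs_iff)
  qed simp
  then show ?thesis by (simp add: of_nat_dvd_zpoly_iff)
qed

text \<open>The triangular system is solved recursively. The quotient needed at \<open>n\<close>
  exists prime by prime: one subtracts Dwork's congruence for the truncated vector
  \<open>c(n := 0)\<close> from the one for \<open>g\<close>.\<close>

lemma dwork_imp_ghost_comp: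
  assumes "dwork g"
  obtains c where "\<And>n. n > 0 \<Longrightarrow> ghost_comp n c = g n"
proof -
  \<comment> \<open>The choice is a true quotient only once divisibility is known, which the
    induction below supplies.\<close>
  define F where "F f n = (SOME z. of_nat n * z = g n - ghost_comp n (f(n := 0)))"
    for f and n :: nat
  define c where "c = wfrec less_than F"
  have c: "c n = (SOME z. of_nat n * z = g n - ghost_comp n (c(n := 0)))" if n: "n > 0" for n
  proof -
    have "c n = F (cut c less_than n) n"
      by (simp add: c_def wfrec[of less_than])
    moreover have "ghost_comp n ((cut c less_than n)(n := 0)) = ghost_comp n (c(n := 0))"
    proof (rule ghost_comp_cong)
      fix e assume "e dvd n"
      then have "e < n \<or> e = n" using n by (auto dest: dvd_imp_le)
      then show "((cut c less_than n)(n := 0)) e = (c(n := 0)) e"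
        by (auto simp: cut_apply)
    qed
    ultimately show ?thesis by (simp add: F_def)
  qed
  have "ghost_comp n c = g n" if "n > 0" for n
    using that
  proof (induction n rule: less_induct)
    case (less n)
    have "of_nat n dvd g n - ghost_comp n (c(n := 0))"
    proof (rule of_nat_dvd_zpolyI[OF less(2)])
      fix p assume p: "prime p" "p dvd n"
      then obtain m where m: "n = p * m" by auto
      have "m > 0" "m < n" using m prime_gt_1_nat[OF p(1)] less(2) by auto
      then have IH: "ghost_comp m c = g m" using less by auto
      have "\<not> n dvd m" using \<open>m > 0\<close> \<open>m < n\<close> by (auto dest: dvd_imp_le)
      then have "ghost_comp m (c(n := 0)) = ghost_comp m c"
        by (intro ghost_comp_cong) auto
      \<comment> \<open>Both sequences have the same value at \<open>m\<close>, so their Frobenius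
        lifts cancel.\<close>
      then have eq: "g n - ghost_comp n (c(n := 0))
          = (g (p * m) - frob_lift p (g m)) - (ghost_comp (p * m) (c(n := 0)) - frob_lift p (ghost_comp m (c(n := 0))))"
        by (simp add: IH m)
      then show "of_nat (p ^ multiplicity p n) dvd g n - ghost_comp n (c(n := 0))"
        unfolding eq
        using dvd_diff[OF dworkD[OF assms p(1) \<open>m > 0\<close>]
            dworkD[OF dwork_ghost_comp[of "c(n := 0)"] p(1) \<open>m > 0\<close>]]
        by (simp only: m)
    qed
    then have "\<exists>z. of_nat n * z = g n - ghost_comp n (c(n := 0))" by (metis dvdE)
    then have "of_nat n * c n = g n - ghost_comp n (c(n := 0))"
      unfolding c[OF less(2)] by (rule someI_ex)
    then show ?case
      using ghost_comp_split[OF less(2), of c] by simp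
  qed
  then show thesis by (rule that)
qed

text \<open>Because \<open>frob_lift p\<close> is a ring homomorphism, Dwork's congruences are
  stable under sums and products. These two closures yield the addition and multiplication of Witt
  vectors.\<close>

lemma dwork_add: "dwork g \<Longrightarrow> dwork h \<Longrightarrow> dwork (\<lambda>n. g n + h n)"
  unfolding dwork_def by (auto simp: frob_lift_simps zpoly_ring_simps add_diff_add intro!: dvd_add)

lemma dwork_mult: "dwork g \<Longrightarrow> dwork h \<Longrightarrow> dwork (\<lambda>n. g n * h n)"
  unfolding dwork_def
proof (intro allI impI)
  fix p n :: nat
  let ?P = "of_nat (p ^ multiplicity p (p * n)) :: 'a zpoly"
  assume gh: "\<forall>p n. prime p \<longrightarrow> n > 0 \<longrightarrow> of_nat (p ^ multiplicity p (p * n)) dvd g (p * n) - frob_lift p (g n)"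
     "\<forall>p n. prime p \<longrightarrow> n > 0 \<longrightarrow> of_nat (p ^ multiplicity p (p * n)) dvd h (p * n) - frob_lift p (h n)"
    and "prime p" "0 < n"
  have "g (p * n) * h (p * n) - frob_lift p (g n * h n)
      = (g (p * n) - frob_lift p (g n)) * h (p * n) + frob_lift p (g n) * (h (p * n) - frob_lift p (h n))"
    by (simp add: frob_lift_simps zpoly_ring_simps algebra_simps)
  with gh \<open>prime p\<close> \<open>0 < n\<close> show "?P dvd g (p * n) * h (p * n) - frob_lift p (g n * h n)"
    by (simp only: dvd_add dvd_mult dvd_mult2)
qed

text \<open>Passing from \<open>n\<close> to \<open>k * n\<close> can only raise the exponent in the
  modulus. This closure yields the Frobenius maps.\<close>

lemma dwork_dilate:
  assumes "dwork g" "k > 0"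
  shows "dwork (\<lambda>n. g (k * n))"
  unfolding dwork_def
proof (intro allI impI)
  fix p n :: nat assume p: "prime p" and n: "n > 0"
  have "multiplicity p (p * n) \<le> multiplicity p (p * (k * n))"
    using p n assms by (intro dvd_imp_multiplicity_le) (auto simp: prime_gt_0_nat)
  then have "(of_nat (p ^ multiplicity p (p * n)) :: 'a zpoly) dvd of_nat (p ^ multiplicity p (p * (k * n)))"
    by (intro of_nat_dvd_of_nat le_imp_power_dvd)
  also have "\<dots> dvd g (p * (k * n)) - frob_lift p (g (k * n))"
    using dworkD[OF assms(1) p, of "k * n"] n assms(2) by simp
  finally show "of_nat (p ^ multiplicity p (p * n)) dvd g (k * (p * n)) - frob_lift p (g (k * n))"
    by (simp add: ac_simps)
qed

section \<open>Universal polynomials for Witt vectors\<close>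

context zpoly_evaluation
begin

text \<open>Naturality of the ghost maps: identities between ghost components of polynomials
  specialize to every ring.\<close>

lemma ghost_ev:
  assumes "n > 0"
  shows "ghost A n (\<lambda>k. ev (c k)) = ev (ghost_comp n c)"
  unfolding ghost_def ghost_comp_def using assms
  by (simp add: ev_sum ev_of_nat_mult ev_power)

end

lemma (in cring) ghost_cong:
  assumes "n > 0" "\<And>e. e > 0 \<Longrightarrow> a e = b e" "\<And>e. e > 0 \<Longrightarrow> b e \<in> carrier R"
  shows "ghost R n a = ghost R n b"
  unfolding ghost_def using assms
  by (intro add.finprod_cong') (auto intro!: add.nat_pow_closed dvd_pos_nat[of n] simp: Pi_iff)

lemma ghost_comp_eq_iff:
  fixes c c' :: "nat \<Rightarrow> 'v zpoly"
  shows "(\<forall>n>0. ghost_comp n c = ghost_comp n c') \<longleftrightarrow> (\<forall>n>0. c n = c' n)"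
proof (intro iffI allI impI)
  fix n :: nat
  show "c n = c' n" if "\<forall>n>0. ghost_comp n c = ghost_comp n c'" "n > 0"
    using that by (auto intro: ghost_comp_inject[of c c'])
  show "ghost_comp n c = ghost_comp n c'" if "\<forall>n>0. c n = c' n" "n > 0"
    using that by (intro ghost_comp_cong) (auto intro: dvd_pos_nat)
qed

lemma zvars_ghost_comp:
  assumes "\<And>e. e dvd n \<Longrightarrow> zvars (c e) \<subseteq> V"
  shows "zvars (ghost_comp n c) \<subseteq> V"
proof -
  have "zvars (of_nat e * c e ^ (n div e)) \<subseteq> V" if "e dvd n" for e
  proof (cases "e = 0")
    case False
    with zvars_power[of "c e" "n div e"] assms[OF that] show ?thesis
      by (simp add: zvars_of_nat_mult)
  qed simp
  then show ?thesis
    unfolding ghost_comp_def using zvars_sum[of "\<lambda>e. of_nat e * c e ^ (n div e)"] by blast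
qed

text \<open>Solving the triangular system introduces no new variables, and neither does division by
  \<open>n\<close>.\<close>

lemma zvars_of_ghost_comp:
  assumes "\<And>n. n > 0 \<Longrightarrow> zvars (ghost_comp n c) \<subseteq> V" "n > 0"
  shows "zvars (c n) \<subseteq> V"
  using \<open>n > 0\<close>
proof (induction n rule: less_induct)
  case (less n)
  have "zvars (ghost_comp n (c(n := 0))) \<subseteq> V"
  proof (rule zvars_ghost_comp)
    fix e assume "e dvd n"
    then have "e > 0" "e < n \<or> e = n" using less(2) by (auto intro: dvd_pos_nat dest: dvd_imp_le)
    then show "zvars ((c(n := 0)) e) \<subseteq> V"
      using less(1)[of e] by (cases "e = n") auto
  qed
  moreover have "of_nat n * c n = ghost_comp n c - ghost_comp n (c(n := 0))"
    using ghost_comp_split[OF less(2), of c] by simp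
  ultimately show ?case
    using zvars_diff[of "ghost_comp n c" "ghost_comp n (c(n := 0))"] assms(1)[OF less(2)]
      zvars_of_nat_mult[OF less(2), of "c n"] by auto
qed

lemma ghost_comp_restrict: "n > 0 \<Longrightarrow> ghost_comp n (restrict c {0<..}) = ghost_comp n c"
  by (intro ghost_comp_cong) (auto intro: dvd_pos_nat)

section \<open>Existence of the universal polynomials\<close>

text \<open>Dwork's lemma gives existence and torsion freeness gives uniqueness, so the definite
  description in \<open>witt_of_ghost\<close> denotes.\<close>

lemma ghost_comp_witt_of_ghost:
  fixes g h :: "nat \<Rightarrow> 'v zpoly"
  assumes "dwork h" and gh: "\<And>n. n > 0 \<Longrightarrow> g n = h n" and "n > 0"
  shows "ghost_comp n (witt_of_ghost zpoly_ring g) = h n"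
proof -
  let ?Q = "\<lambda>c. c \<in> {0<..} \<rightarrow>\<^sub>E carrier zpoly_ring \<and> (\<forall>n>0. ghost zpoly_ring n c = g n)"
  obtain c where "\<And>n. n > 0 \<Longrightarrow> ghost_comp n c = h n"
    using dwork_imp_ghost_comp[OF assms(1)] by blast
  then have Q_c: "?Q (restrict c {0<..})"
    by (simp add: ghost_zpoly_ring ghost_comp_restrict zpoly_ring_simps gh)
  have uniq: "c = c'" if "?Q c" "?Q c'" for c c'
  proof (rule extensionalityI[where A = "{0<..}"])
    have "ghost_comp n c = ghost_comp n c'" if "n > 0" for n
      using \<open>?Q c\<close> \<open>?Q c'\<close> that by (simp flip: ghost_zpoly_ring)
    then show "c n = c' n" if "n \<in> {0<..}" for n
      using that by (auto intro: ghost_comp_inject)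
  qed (use that in \<open>auto simp: PiE_iff\<close>)
  have "\<exists>!c. ?Q c"
    by (rule ex1I[of ?Q]) (rule Q_c, erule uniq[OF _ Q_c])
  from theI'[OF this] show ?thesis
    using \<open>n > 0\<close> unfolding witt_of_ghost_def by (simp add: ghost_zpoly_ring gh)
qed

lemma ghost_comp_add_poly:
  "n > 0 \<Longrightarrow> ghost_comp n add_poly
     = ghost_comp n (\<lambda>k. zpoly_var (Inl k)) + ghost_comp n (\<lambda>k. zpoly_var (Inr k))"
  unfolding add_poly_def
  by (rule ghost_comp_witt_of_ghost)
    (simp_all add: ghost_zpoly_ring zpoly_ring_simps dwork_add dwork_ghost_comp)

lemma ghost_comp_mult_poly:
  "n > 0 \<Longrightarrow> ghost_comp n mult_poly
     = ghost_comp n (\<lambda>k. zpoly_var (Inl k)) * ghost_comp n (\<lambda>k. zpoly_var (Inr k))"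
  unfolding mult_poly_def
  by (rule ghost_comp_witt_of_ghost)
    (simp_all add: ghost_zpoly_ring zpoly_ring_simps dwork_mult dwork_ghost_comp)

lemma ghost_comp_frobenius_poly:
  assumes "m > 0" "n > 0"
  shows "ghost_comp n (frobenius_poly m) = ghost_comp (m * n) zpoly_var"
  unfolding frobenius_poly_def
  by (rule ghost_comp_witt_of_ghost[OF dwork_dilate[OF dwork_ghost_comp]])
    (simp_all add: ghost_zpoly_ring assms)

lemma zvars_ghost_comp_var:
  assumes "n > 0" "\<And>e. e > 0 \<Longrightarrow> f e \<in> V"
  shows "zvars (ghost_comp n (\<lambda>e. zpoly_var (f e))) \<subseteq> V"
  by (rule zvars_ghost_comp) (use assms in \<open>auto intro: dvd_pos_nat\<close>)

lemma zvars_add_poly: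
  "n > 0 \<Longrightarrow> zvars (add_poly n) \<subseteq> Inl ` {0<..} \<union> Inr ` {0<..}"
  by (rule zvars_of_ghost_comp, simp only: ghost_comp_add_poly,
      intro order.trans[OF zvars_add] Un_least zvars_ghost_comp_var) auto

lemma zvars_mult_poly:
  "n > 0 \<Longrightarrow> zvars (mult_poly n) \<subseteq> Inl ` {0<..} \<union> Inr ` {0<..}"
  by (rule zvars_of_ghost_comp, simp only: ghost_comp_mult_poly,
      intro order.trans[OF zvars_mult] Un_least zvars_ghost_comp_var) auto

lemma zvars_frobenius_poly: "m > 0 \<Longrightarrow> n > 0 \<Longrightarrow> zvars (frobenius_poly m n) \<subseteq> {0<..}"
  by (rule zvars_of_ghost_comp) (simp_all add: ghost_comp_frobenius_poly zvars_ghost_comp_var)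

lemma zpoly_eval_zpoly_var [simp]: "zpoly_eval zpoly_ring zpoly_var p = p"
proof -
  interpret zpoly_evaluation zpoly_ring "zpoly_var :: 'a \<Rightarrow> _"
    by (rule zpoly_evaluation_zpoly_ring)
  show ?thesis
    using subset_UNIV[of "zvars p"]
  proof (induction p rule: zpoly_induct)
    case (uminus p)
    then show ?case
      using ev_add[of p "- p"] by (simp add: zpoly_ring_simps eq_neg_iff_add_eq_0 add.commute)
  qed (simp_all add: ev_add ev_mult zpoly_ring_simps)
qed

section \<open>Witt vectors over a polynomial ring\<close>

abbreviation zwitt :: "(nat \<Rightarrow> 'v zpoly) ring" where
  "zwitt \<equiv> witt_ring zpoly_ring"

lemma ghost_comp_zwitt_add:
  assumes "n > 0"
  shows "ghost_comp n (a \<oplus>\<^bsub>zwitt\<^esub> b) = ghost_comp n a + ghost_comp n b"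
proof -
  interpret zpoly_evaluation zpoly_ring "case_sum a b"
    by (rule zpoly_evaluation_zpoly_ring)
  have "ghost_comp n (a \<oplus>\<^bsub>zwitt\<^esub> b) = ghost zpoly_ring n (\<lambda>k. ev (add_poly k))"
    using assms by (simp add: witt_ring_def ghost_comp_restrict ghost_zpoly_ring)
  also have "\<dots> = ghost zpoly_ring n (\<lambda>k. ev (zpoly_var (Inl k)))
      + ghost zpoly_ring n (\<lambda>k. ev (zpoly_var (Inr k)))"
    using assms by (simp only: ghost_ev ghost_comp_add_poly ev_add zpoly_ring_simps)
  finally show ?thesis using assms by (simp add: ghost_zpoly_ring)
qed

lemma ghost_comp_zwitt_mult:
  assumes "n > 0"
  shows "ghost_comp n (a \<otimes>\<^bsub>zwitt\<^esub> b) = ghost_comp n a * ghost_comp n b"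
proof -
  interpret zpoly_evaluation zpoly_ring "case_sum a b"
    by (rule zpoly_evaluation_zpoly_ring)
  have "ghost_comp n (a \<otimes>\<^bsub>zwitt\<^esub> b) = ghost zpoly_ring n (\<lambda>k. ev (mult_poly k))"
    using assms by (simp add: witt_ring_def ghost_comp_restrict ghost_zpoly_ring)
  also have "\<dots> = ghost zpoly_ring n (\<lambda>k. ev (zpoly_var (Inl k)))
      * ghost zpoly_ring n (\<lambda>k. ev (zpoly_var (Inr k)))"
    using assms by (simp only: ghost_ev ghost_comp_mult_poly ev_mult zpoly_ring_simps)
  finally show ?thesis using assms by (simp add: ghost_zpoly_ring)
qed

lemma ghost_comp_zwitt_zero: "n > 0 \<Longrightarrow> ghost_comp n \<zero>\<^bsub>zwitt\<^esub> = 0"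
  by (simp add: witt_ring_def ghost_comp_restrict) (auto simp: ghost_comp_def zpoly_ring_simps dvd_div_eq_0_iff power_0_left intro!: sum.neutral)

lemma ghost_comp_unit:
  assumes "n > 0"
  shows "ghost_comp n (\<lambda>k. if k = 1 then 1 else 0) = (1 :: 'r::comm_ring_1)"
proof -
  have "ghost_comp n (\<lambda>k. if k = 1 then 1 else 0) = (\<Sum>e | e dvd n. if e = 1 then 1 else 0 :: 'r)"
    unfolding ghost_comp_def using assms
    by (intro sum.cong) (auto simp: dvd_div_eq_0_iff power_0_left)
  then show ?thesis using assms by simp
qed

lemma ghost_comp_zwitt_one: "n > 0 \<Longrightarrow> ghost_comp n \<one>\<^bsub>zwitt\<^esub> = 1"
  using ghost_comp_unit[of n]
  by (simp add: witt_ring_def ghost_comp_restrict zpoly_ring_simps cong: if_cong)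

text \<open>The ghost maps are jointly injective here, so each law of \<open>zwitt\<close> follows
  from the same law in the polynomial ring.\<close>

lemma zwitt_ext:
  assumes "a \<in> carrier zwitt" "b \<in> carrier zwitt" "\<And>n. n > 0 \<Longrightarrow> ghost_comp n a = ghost_comp n b"
  shows "a = b"
  using assms(1,2) ghost_comp_inject[OF assms(3)]
  by (auto simp: witt_ring_def PiE_iff intro!: extensionalityI[where A = "{0<..}"])

lemma zwitt_closed:
  "a \<oplus>\<^bsub>zwitt\<^esub> b \<in> carrier zwitt" "a \<otimes>\<^bsub>zwitt\<^esub> b \<in> carrier zwitt"
  "\<zero>\<^bsub>zwitt\<^esub> \<in> carrier zwitt" "\<one>\<^bsub>zwitt\<^esub> \<in> carrier zwitt"
  by (simp_all add: witt_ring_def zpoly_ring_simps)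

lemma abelian_monoid_zwitt: "abelian_monoid zwitt"
  by (rule abelian_monoidI)
    (auto intro!: zwitt_ext simp: zwitt_closed ghost_comp_zwitt_add ghost_comp_zwitt_zero algebra_simps)

lemma monoid_zwitt: "Group.monoid zwitt"
  by (rule monoidI)
    (auto intro!: zwitt_ext simp: zwitt_closed ghost_comp_zwitt_mult ghost_comp_zwitt_one algebra_simps)

lemma ghost_zwitt_closed:
  assumes "c \<in> {0<..} \<rightarrow> carrier zwitt" "n > 0"
  shows "ghost zwitt n c \<in> carrier zwitt"
proof -
  interpret abelian_monoid zwitt by (rule abelian_monoid_zwitt)
  interpret mult: Group.monoid zwitt by (rule monoid_zwitt)
  show ?thesis
    unfolding ghost_def using assms
    by (intro finsum_closed Pi_I add.nat_pow_closed mult.nat_pow_closed)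
      (auto intro: dvd_pos_nat)
qed

text \<open>\<open>ghost_comp m\<close> respects the operations of \<open>zwitt\<close>, so it
  passes through the sums, multiples and powers that make up \<open>ghost zwitt n\<close>.\<close>

lemma ghost_comp_ghost_zwitt:
  assumes "c \<in> {0<..} \<rightarrow> carrier zwitt" "m > 0" "n > 0"
  shows "ghost_comp m (ghost zwitt n c) = ghost_comp n (\<lambda>e. ghost_comp m (c e))"
proof -
  interpret abelian_monoid zwitt by (rule abelian_monoid_zwitt)
  interpret mult: Group.monoid zwitt by (rule monoid_zwitt)
  have finsum: "ghost_comp m (\<Oplus>\<^bsub>zwitt\<^esub>i\<in>I. f i) = (\<Sum>i\<in>I. ghost_comp m (f i))"
    if "finite I" "f \<in> I \<rightarrow> carrier zwitt" for f and I :: "nat set"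
    using that by (induction rule: finite_induct)
      (simp_all add: Pi_iff ghost_comp_zwitt_add ghost_comp_zwitt_zero assms(2))
  have pow: "ghost_comp m (x [^]\<^bsub>zwitt\<^esub> k) = ghost_comp m x ^ k" for x and k :: nat
    by (induction k) (simp_all add: ghost_comp_zwitt_mult ghost_comp_zwitt_one assms(2) mult.commute)
  have add_pow: "ghost_comp m ([k] \<cdot>\<^bsub>zwitt\<^esub> x) = of_nat k * ghost_comp m x" for x and k :: nat
    by (induction k)
      (simp_all add: ghost_comp_zwitt_add ghost_comp_zwitt_zero assms(2) algebra_simps)
  have "ghost_comp m (ghost zwitt n c)
      = (\<Sum>e | e dvd n. ghost_comp m ([e] \<cdot>\<^bsub>zwitt\<^esub> (c e [^]\<^bsub>zwitt\<^esub> (n div e))))"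
    unfolding ghost_def using assms
    by (intro finsum Pi_I add.nat_pow_closed mult.nat_pow_closed) (auto intro: dvd_pos_nat)
  also have "\<dots> = ghost_comp n (\<lambda>e. ghost_comp m (c e))"
    by (simp add: add_pow pow ghost_comp_def[of n])
  finally show ?thesis .
qed

section \<open>Comultiplication polynomials\<close>

text \<open>The component \<open>e\<close> is fixed and the Frobenius index varies. Dwork's
  congruences for the tautological vector at \<open>m * k\<close> make the ghost components of
  \<open>frobenius_poly (p * m)\<close> and of the lift of \<open>frobenius_poly m\<close>
  congruent, and this descends to the components.\<close>

lemma dwork_frobenius_poly:
  assumes "e > 0"
  shows "dwork (\<lambda>m. frobenius_poly m e)"
  unfolding dwork_def
proof (intro allI impI)
  fix p m :: nat assume p: "prime p" and m: "m > 0"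
  let ?r = "multiplicity p (p * m)"
  have p0: "p > 0" using p by (simp add: prime_gt_0_nat)
  have "?r > 0" using p p0 m by (subst multiplicity_gt_zero_iff) auto
  then show "of_nat (p ^ ?r) dvd frobenius_poly (p * m) e - frob_lift p (frobenius_poly m e)"
  proof (rule cong_of_ghost_comp_cong[OF p _ assms])
    fix k :: nat assume k: "k > 0"
    \<comment> \<open>The modulus contains exactly the surplus \<open>multiplicity p k\<close> that
      the descent consumes.\<close>
    have "?r + multiplicity p k = multiplicity p (p * (m * k))"
      using p p0 m k by (simp add: prime_elem_multiplicity_mult_distrib)
    then show "of_nat (p ^ (?r + multiplicity p k)) dvd
        ghost_comp k (frobenius_poly (p * m)) - ghost_comp k (\<lambda>e. frob_lift p (frobenius_poly m e))"
      using dworkD[OF dwork_ghost_comp[of zpoly_var] p, of "m * k"] p0 m k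
      by (simp add: ghost_comp_frobenius_poly mult.assoc flip: frob_lift_ghost_comp)
  qed
qed

lemma frobenius_zpoly_var:
  assumes "n > 0"
  shows "frobenius zpoly_ring n (\<lambda>k\<in>{0<..}. zpoly_var k) = restrict (frobenius_poly n) {0<..}"
  unfolding frobenius_def
proof (rule restrict_ext)
  fix k :: nat assume k: "k \<in> {0<..}"
  interpret zpoly_evaluation zpoly_ring "zpoly_var :: nat \<Rightarrow> _"
    by (rule zpoly_evaluation_zpoly_ring)
  have "zpoly_eval zpoly_ring (\<lambda>k\<in>{0<..}. zpoly_var k) (frobenius_poly n k) = ev (frobenius_poly n k)"
    using zvars_frobenius_poly[OF assms, of k] k by (intro ev_cong) auto
  then show "zpoly_eval zpoly_ring (\<lambda>k\<in>{0<..}. zpoly_var k) (frobenius_poly n k) = frobenius_poly n k"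
    by simp
qed

text \<open>The definition prescribes ghost components over \<open>zwitt\<close>. Taking ghost
  components once more gives a double family depending only on the product of the indices.
  Exchanging them turns the prescription into one for each \<open>comult_poly e\<close>
  separately.\<close>

lemma ghost_comp_comult_poly:
  assumes "e > 0" "m > 0"
  shows "ghost_comp m (comult_poly e) = frobenius_poly m e"
proof -
  let ?X = "\<lambda>k\<in>{0<..}. zpoly_var k :: nat zpoly"
  let ?Q = "\<lambda>c. c \<in> {0<..} \<rightarrow>\<^sub>E carrier zwitt \<and> (\<forall>n>0. ghost zwitt n c = frobenius zpoly_ring n ?X)"
  have Q_iff: "?Q c \<longleftrightarrow> c \<in> {0<..} \<rightarrow>\<^sub>E carrier zwitt \<and>
      (\<forall>m>0. \<forall>e>0. ghost_comp m (c e) = frobenius_poly m e)" (is "_ \<longleftrightarrow> ?R c") for c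
  proof (rule conj_cong[OF refl])
    assume c: "c \<in> {0<..} \<rightarrow>\<^sub>E carrier zwitt"
    then have c': "c \<in> {0<..} \<rightarrow> carrier zwitt" by (simp add: PiE_iff Pi_iff)
    have gh: "ghost zwitt n c = frobenius zpoly_ring n ?X \<longleftrightarrow>
       (\<forall>m>0. ghost_comp n (\<lambda>e. ghost_comp m (c e)) = ghost_comp (n * m) zpoly_var)" if "n > 0" for n
    proof -
      have "ghost zwitt n c = frobenius zpoly_ring n ?X \<longleftrightarrow>
        (\<forall>m>0. ghost_comp m (ghost zwitt n c) = ghost_comp m (frobenius zpoly_ring n ?X))"
      proof (rule iffI, simp, rule zwitt_ext[OF ghost_zwitt_closed[OF c' that]])
        show "frobenius zpoly_ring n ?X \<in> carrier zwitt"
          by (simp add: frobenius_def witt_ring_def zpoly_ring_simps)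
      qed simp
      then show ?thesis
        using that by (simp add: ghost_comp_ghost_zwitt[OF c'] frobenius_zpoly_var
            ghost_comp_restrict ghost_comp_frobenius_poly)
    qed
    \<comment> \<open>By symmetry of \<open>n * m\<close>, the outer ghost map can be stripped off
      with \<open>m\<close> fixed.\<close>
    have "(\<forall>n>0. ghost zwitt n c = frobenius zpoly_ring n ?X) \<longleftrightarrow>
        (\<forall>m>0. \<forall>n>0. ghost_comp n (\<lambda>e. ghost_comp m (c e)) = ghost_comp n (frobenius_poly m))"
      by (auto simp: gh ghost_comp_frobenius_poly mult.commute)
    also have "\<dots> \<longleftrightarrow> (\<forall>m>0. \<forall>e>0. ghost_comp m (c e) = frobenius_poly m e)"
      by (simp only: ghost_comp_eq_iff)
    finally show "(\<forall>n>0. ghost zwitt n c = frobenius zpoly_ring n ?X) \<longleftrightarrow>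
      (\<forall>m>0. \<forall>e>0. ghost_comp m (c e) = frobenius_poly m e)" .
  qed
  have "\<exists>C. \<forall>m>0. ghost_comp m C = frobenius_poly m e" if "e > 0" for e
    using dwork_imp_ghost_comp[OF dwork_frobenius_poly[OF that]] by metis
  then obtain C where C: "\<And>m e. m > 0 \<Longrightarrow> e > 0 \<Longrightarrow> ghost_comp m (C e) = frobenius_poly m e"
    by metis
  \<comment> \<open>Values at index 0 are reset to the dummy that the carrier of
    \<open>zwitt\<close> demands.\<close>
  define C' where "C' e = restrict (C e) {0<..}" for e
  have "C' e \<in> carrier zwitt" for e
    by (simp add: C'_def witt_ring_def zpoly_ring_simps)
  moreover have "ghost_comp m (C' e) = frobenius_poly m e" if "m > 0" "e > 0" for m e
    unfolding C'_def using that by (simp only: ghost_comp_restrict C)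
  ultimately have R_C: "?R (restrict C' {0<..})"
    by (simp add: PiE_iff extensional_def)
  have uniq: "c = c'" if "?R c" "?R c'" for c c'
  proof (rule extensionalityI[where A = "{0<..}"])
    show "c e = c' e" if "e \<in> {0<..}" for e
      using \<open>?R c\<close> \<open>?R c'\<close> that by (intro zwitt_ext) auto
  qed (use that in \<open>auto simp: PiE_iff\<close>)
  have "\<exists>!c. ?Q c"
    unfolding Q_iff by (rule ex1I[of ?R]) (rule R_C, erule uniq[OF _ R_C])
  from theI'[OF this] have "?R comult_poly"
    unfolding comult_poly_def witt_of_ghost_def Q_iff by simp
  then show ?thesis using assms by blast
qed

lemma zvars_comult_poly: "e > 0 \<Longrightarrow> k > 0 \<Longrightarrow> zvars (comult_poly e k) \<subseteq> {0<..}"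
  by (rule zvars_of_ghost_comp) (simp_all add: ghost_comp_comult_poly zvars_frobenius_poly)

lemma ghost_comp_ghost_comp_comult_poly:
  assumes "m > 0" "n > 0"
  shows "ghost_comp n (\<lambda>e. ghost_comp m (comult_poly e)) = ghost_comp (m * n) zpoly_var"
  unfolding ghost_comp_frobenius_poly[OF assms, symmetric]
  using assms by (intro ghost_comp_cong ghost_comp_comult_poly) (auto intro: dvd_pos_nat)

section \<open>Partial derivatives and the chain rule\<close>

text \<open>The partial derivative is the linear coefficient after adding a new variable to the given one.\<close>

abbreviation pd_point :: "'v \<Rightarrow> 'v \<Rightarrow> 'v zpoly poly" where
  "pd_point v \<equiv> (\<lambda>w. if w = v then [:zpoly_var w, 1:] else [:zpoly_var w:])"

definition pd :: "'v \<Rightarrow> 'v zpoly \<Rightarrow> 'v zpoly" where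
  "pd v p = poly.coeff (zpoly_eval ring_of_type_algebra (pd_point v) p) 1"

interpretation pd_point: zpoly_evaluation "ring_of_type_algebra :: 'v zpoly poly ring" "pd_point v"
  for v :: 'v
  by (simp add: zpoly_evaluation_def cring_from_type_algebra zpoly_evaluation_axioms_def
      ring_of_type_algebra_simps)

lemma zpoly_eval_pd_point_uminus:
  "zpoly_eval ring_of_type_algebra (pd_point v) (- p) = - zpoly_eval ring_of_type_algebra (pd_point v) p"
  using pd_point.ev_add[of v p "- p"]
  by (simp add: ring_of_type_algebra_simps eq_neg_iff_add_eq_0 add.commute)

text \<open>Setting the new variable to 0 recovers \<open>p\<close>. The product rule takes its
  constant coefficients from here.\<close>

lemma coeff_0_pd_point:
  "poly.coeff (zpoly_eval ring_of_type_algebra (pd_point v) p) 0 = p"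
  using subset_UNIV[of "zvars p"]
  by (induction p rule: zpoly_induct)
    (simp_all add: pd_point.ev_add pd_point.ev_mult zpoly_eval_pd_point_uminus
      ring_of_type_algebra_simps coeff_mult)

lemma pd_add: "pd v (p + q) = pd v p + pd v q"
  by (simp add: pd_def pd_point.ev_add ring_of_type_algebra_simps)

lemma pd_uminus: "pd v (- p) = - pd v p"
  by (simp add: pd_def zpoly_eval_pd_point_uminus)

lemma pd_mult: "pd v (p * q) = q * pd v p + p * pd v q"
  by (simp add: pd_def pd_point.ev_mult ring_of_type_algebra_simps coeff_mult coeff_0_pd_point
      flip: One_nat_def) (simp add: coeff_0_pd_point)

lemma pd_zero [simp]: "pd v 0 = 0"
  by (simp add: pd_def ring_of_type_algebra_simps)

lemma pd_one [simp]: "pd v 1 = 0"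
  by (simp add: pd_def ring_of_type_algebra_simps)

lemma pd_var: "pd v (zpoly_var w) = (if w = v then 1 else 0)"
  by (simp add: pd_def)

lemma pd_of_nat_mult: "pd v (of_nat n * p) = of_nat n * pd v p"
  by (induction n) (simp_all add: distrib_right pd_add)

lemma pd_power: "pd v (p ^ n) = of_nat n * (p ^ (n - 1) * pd v p)"
proof (induction n)
  case (Suc n)
  then show ?case by (cases n) (simp_all add: pd_mult algebra_simps)
qed simp

lemma pd_sum: "pd v (\<Sum>i\<in>I. f i) = (\<Sum>i\<in>I. pd v (f i))"
  by (induction I rule: infinite_finite_induct) (simp_all add: pd_add)

section \<open>Derivatives of ghost components\<close>

text \<open>The \<open>v\<close>-coefficient of \<open>D\<^sub>n\<close> over the polynomial ring:
  the derivative of the ghost component with its factor \<open>n\<close> already removed.\<close>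

definition ghost_pd :: "'v \<Rightarrow> nat \<Rightarrow> (nat \<Rightarrow> 'v zpoly) \<Rightarrow> 'v zpoly" where
  "ghost_pd v n c = (\<Sum>e | e dvd n. c e ^ (n div e - 1) * pd v (c e))"

text \<open>Differentiating the summand at \<open>e\<close> produces the factor
  \<open>e * (n div e) = n\<close>, the same for every divisor.\<close>

lemma pd_ghost_comp: "pd v (ghost_comp n c) = of_nat n * ghost_pd v n c"
  unfolding ghost_comp_def ghost_pd_def pd_sum sum_distrib_left
  by (intro sum.cong) (auto simp: pd_of_nat_mult pd_power mult.assoc elim!: dvdE)

text \<open>Differentiating the ghost identity gives \<open>n\<close> times the claim, and
  \<open>n\<close> cancels over the polynomial ring. The product rule below arises likewise.\<close>

lemma ghost_pd_add_poly:
  assumes "n > 0"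
  shows "ghost_pd v n add_poly
    = ghost_pd v n (\<lambda>k. zpoly_var (Inl k)) + ghost_pd v n (\<lambda>k. zpoly_var (Inr k))"
  using ghost_comp_add_poly[OF assms, THEN arg_cong[where f = "pd v"]] assms
  by (simp add: pd_add pd_ghost_comp of_nat_mult_zpoly_cancel flip: distrib_left)

lemma ghost_pd_mult_poly:
  assumes "n > 0"
  shows "ghost_pd v n mult_poly
    = ghost_comp n (\<lambda>k. zpoly_var (Inr k)) * ghost_pd v n (\<lambda>k. zpoly_var (Inl k))
      + ghost_comp n (\<lambda>k. zpoly_var (Inl k)) * ghost_pd v n (\<lambda>k. zpoly_var (Inr k))"
proof -
  have "of_nat n * ghost_pd v n mult_poly
     = of_nat n * (ghost_comp n (\<lambda>k. zpoly_var (Inr k)) * ghost_pd v n (\<lambda>k. zpoly_var (Inl k))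
      + ghost_comp n (\<lambda>k. zpoly_var (Inl k)) * ghost_pd v n (\<lambda>k. zpoly_var (Inr k)))"
    using ghost_comp_mult_poly[OF assms, THEN arg_cong[where f = "pd v"]]
    by (simp add: pd_mult pd_ghost_comp algebra_simps)
  then show ?thesis by (simp only: of_nat_mult_zpoly_cancel[OF assms])
qed

text \<open>The outer ghost component yields a factor \<open>n\<close> and each inner one a factor
  \<open>m\<close>, so both sides carry \<open>m * n\<close>.\<close>

lemma ghost_pd_comult_poly:
  assumes "m > 0" "n > 0"
  shows "(\<Sum>e | e dvd n. ghost_comp m (comult_poly e) ^ (n div e - 1) * ghost_pd v m (comult_poly e))
    = ghost_pd v (m * n) zpoly_var"
proof -
  have "of_nat (m * n) * ghost_pd v (m * n) zpoly_var
      = of_nat n * ghost_pd v n (\<lambda>e. ghost_comp m (comult_poly e))"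
    using ghost_comp_ghost_comp_comult_poly[OF assms, THEN arg_cong[where f = "pd v"]]
    by (simp only: pd_ghost_comp)
  also have "\<dots> = of_nat (m * n)
      * (\<Sum>e | e dvd n. ghost_comp m (comult_poly e) ^ (n div e - 1) * ghost_pd v m (comult_poly e))"
    unfolding ghost_pd_def[of v n] pd_ghost_comp sum_distrib_left
    by (intro sum.cong) (simp_all add: algebra_simps)
  finally show ?thesis
    using assms of_nat_mult_zpoly_cancel[of "m * n"] by simp
qed

section \<open>Specialization to an arbitrary derivation\<close>

definition ghost_deriv ::
  "('a, 'b) ring_scheme \<Rightarrow> ('a, 'c, 'd) module_scheme \<Rightarrow> ('a \<Rightarrow> 'c) \<Rightarrow> nat \<Rightarrow> (nat \<Rightarrow> 'a) \<Rightarrow> 'c"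
where
  "ghost_deriv A M D n a =
     (\<Oplus>\<^bsub>M\<^esub>e\<in>{e. e dvd n}. (a e [^]\<^bsub>A\<^esub> (n div e - 1)) \<odot>\<^bsub>M\<^esub> D (a e))"

context derivation
begin

lemma ghost_deriv_cong:
  assumes "n > 0" "\<And>e. e > 0 \<Longrightarrow> a e = b e" "\<And>e. e > 0 \<Longrightarrow> b e \<in> carrier A"
  shows "ghost_deriv A M D n a = ghost_deriv A M D n b"
proof -
  have "e > 0" if "e dvd n" for e using assms(1) that by (auto intro: dvd_pos_nat)
  then show ?thesis
    unfolding ghost_deriv_def using assms
    by (intro M.finsum_cong') (auto intro!: smult_closed D_closed)
qed

lemma ghost_deriv_closed:
  assumes "n > 0" "\<And>e. e > 0 \<Longrightarrow> a e \<in> carrier A"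
  shows "ghost_deriv A M D n a \<in> carrier M"
proof -
  have "e > 0" if "e dvd n" for e using assms(1) that by (auto intro: dvd_pos_nat)
  then show ?thesis
    unfolding ghost_deriv_def using assms
    by (intro M.finsum_closed) (auto intro!: smult_closed D_closed)
qed

lemma D_one: "D \<one> = \<zero>\<^bsub>M\<^esub>"
proof -
  have "D \<one> = D \<one> \<oplus>\<^bsub>M\<^esub> D \<one>"
    using D_mult[of \<one> \<one>] D_closed[of \<one>] by simp
  then show ?thesis using D_closed[of \<one>] by (metis M.add.r_cancel_one' R.one_closed)
qed

lemma D_zero: "D \<zero> = \<zero>\<^bsub>M\<^esub>"
proof -
  have "D \<zero> = D \<zero> \<oplus>\<^bsub>M\<^esub> D \<zero>"
    using D_add[of \<zero> \<zero>] by simp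
  then show ?thesis using D_closed[of \<zero>] by (metis M.add.r_cancel_one' R.zero_closed)
qed

lemma D_a_inv: "a \<in> carrier A \<Longrightarrow> D (\<ominus> a) = \<ominus>\<^bsub>M\<^esub> D a"
  using D_add[of "\<ominus> a" a] D_closed
  by (intro M.minus_equality[symmetric]) (simp_all add: R.l_neg D_zero)

end

locale zpoly_derivation = derivation A M D + zpoly_evaluation A x
  for A :: "('a, 'b) ring_scheme" (structure) and M :: "('a, 'c, 'd) module_scheme" (structure)
    and D and x :: "'v \<Rightarrow> 'a" +
  fixes V :: "'v set"
  assumes finite_V: "finite V"
begin

text \<open>The image in \<open>M\<close> of the differential form with coefficients
  \<open>\<omega> v\<close> on the variables in \<open>V\<close>, under the map of differentials
  induced by \<open>x\<close> and \<open>D\<close>.\<close>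

definition contract :: "('v \<Rightarrow> 'v zpoly) \<Rightarrow> 'c" where
  "contract \<omega> = (\<Oplus>\<^bsub>M\<^esub>v\<in>V. ev (\<omega> v) \<odot>\<^bsub>M\<^esub> D (x v))"

lemma Dx_closed [simp]: "D (x v) \<in> carrier M"
  by (simp add: D_closed var_closed)

lemma contract_closed [simp]: "contract \<omega> \<in> carrier M"
  unfolding contract_def by (intro M.finsum_closed) auto

lemma contract_zero [simp]: "contract (\<lambda>v. 0) = \<zero>\<^bsub>M\<^esub>"
  unfolding contract_def by (simp add: M.finsum_zero)

lemma contract_add: "contract (\<lambda>v. \<omega> v + \<eta> v) = contract \<omega> \<oplus>\<^bsub>M\<^esub> contract \<eta>"
  unfolding contract_def
  by (simp add: ev_add smult_l_distr M.finsum_addf Pi_iff)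

lemma contract_mult: "contract (\<lambda>v. p * \<omega> v) = ev p \<odot>\<^bsub>M\<^esub> contract \<omega>"
  unfolding contract_def
  by (simp add: ev_mult smult_assoc1 finsum_smult_ldistr[OF finite_V] Pi_iff)

lemma contract_sum:
  "finite I \<Longrightarrow>
    contract (\<lambda>v. \<Sum>i\<in>I. p i * \<omega> i v) = (\<Oplus>\<^bsub>M\<^esub>i\<in>I. ev (p i) \<odot>\<^bsub>M\<^esub> contract (\<omega> i))"
  by (induction rule: finite_induct) (simp_all add: contract_add contract_mult Pi_iff)

text \<open>The chain rule: both sides are derivations along \<open>ev\<close>, and they agree on
  the variables in \<open>V\<close>.\<close>

lemma D_ev: "zvars p \<subseteq> V \<Longrightarrow> D (ev p) = contract (\<lambda>v. pd v p)"
proof (induction p rule: zpoly_induct)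
  case (var w)
  have "contract (\<lambda>v. pd v (zpoly_var w)) = (\<Oplus>\<^bsub>M\<^esub>v\<in>V. if w = v then D (x v) else \<zero>\<^bsub>M\<^esub>)"
    unfolding contract_def pd_var by (intro M.finsum_cong') auto
  also have "\<dots> = D (x w)"
    using var finite_V by (intro M.finsum_singleton) auto
  finally show ?case by simp
next
  case (uminus p)
  have "contract (\<lambda>v. pd v (- p)) = contract (\<lambda>v. - 1 * pd v p)"
    by (simp add: pd_uminus)
  also have "\<dots> = \<ominus>\<^bsub>M\<^esub> contract (\<lambda>v. pd v p)"
    unfolding contract_mult by (simp add: ev_uminus smult_l_minus)
  finally show ?case using uminus by (simp add: ev_uminus D_a_inv)
next
  case (add p q)
  then show ?case by (simp add: ev_add D_add pd_add contract_add)
next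
  case (mult p q)
  then show ?case by (simp add: ev_mult D_mult pd_mult contract_add contract_mult)
qed (simp_all add: D_one)

text \<open>Through this formula the identities between the \<open>ghost_pd\<close> hold in every
  \<open>M\<close>, even one with torsion.\<close>

lemma ghost_deriv_ev:
  assumes "n > 0" "\<And>e. e dvd n \<Longrightarrow> zvars (c e) \<subseteq> V"
  shows "ghost_deriv A M D n (\<lambda>k. ev (c k)) = contract (\<lambda>v. ghost_pd v n c)"
  unfolding ghost_deriv_def ghost_pd_def using assms
  by (simp add: contract_sum ev_power D_ev cong: M.finsum_cong)

end

section \<open>Adams operations and the operations on differentials\<close>

lemma (in ring_hom_cring) hom_add_pow:
  "x \<in> carrier R \<Longrightarrow> h ([(k::nat)] \<cdot>\<^bsub>R\<^esub> x) = [k] \<cdot>\<^bsub>S\<^esub> h x"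
  by (induction k) simp_all

lemma (in ring_hom_cring) hom_pow:
  "x \<in> carrier R \<Longrightarrow> h (x [^]\<^bsub>R\<^esub> (k::nat)) = h x [^]\<^bsub>S\<^esub> k"
  by (induction k) simp_all

lemma (in ring_hom_cring) hom_ghost:
  assumes "n > 0" "\<And>e. e > 0 \<Longrightarrow> a e \<in> carrier R"
  shows "h (ghost R n a) = ghost S n (\<lambda>e. h (a e))"
proof -
  have "e > 0" if "e dvd n" for e using assms(1) that by (auto intro: dvd_pos_nat)
  then show ?thesis
    unfolding ghost_def using assms
    by (subst hom_finsum) (auto intro!: S.finsum_cong' simp: hom_add_pow hom_pow)
qed

context lambda_ring
begin

lemma lam_closed: "a \<in> carrier A \<Longrightarrow> e > 0 \<Longrightarrow> lam a e \<in> carrier A"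
  using ring_hom_closed[OF lam_hom, of a] by (auto simp: witt_ring_def)

text \<open>The dummy value of a Witt vector at the index 0 need not lie in the ring.\<close>

definition lam0 :: "'a \<Rightarrow> nat \<Rightarrow> 'a" where
  "lam0 a k = (if k = 0 then \<zero> else lam a k)"

lemma lam0_eq: "k > 0 \<Longrightarrow> lam0 a k = lam a k"
  by (simp add: lam0_def)

lemma lam0_closed: "a \<in> carrier A \<Longrightarrow> lam0 a k \<in> carrier A"
  by (simp add: lam0_def lam_closed)

lemma zpoly_evaluation_lam0: "a \<in> carrier A \<Longrightarrow> zpoly_evaluation A (lam0 a)"
  by unfold_locales (rule lam0_closed)

lemma zpoly_evaluation_lam0_sum:
  "a \<in> carrier A \<Longrightarrow> b \<in> carrier A \<Longrightarrow> zpoly_evaluation A (case_sum (lam0 a) (lam0 b))"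
  by unfold_locales (auto simp: lam0_closed split: sum.split)

text \<open>The universal polynomial involves positive indices only, so \<open>lam\<close> may be
  replaced by \<open>lam0\<close>, which stays in the ring.\<close>

lemma lam_add:
  assumes "a \<in> carrier A" "b \<in> carrier A" "k > 0"
  shows "lam (a \<oplus> b) k = zpoly_eval A (case_sum (lam0 a) (lam0 b)) (add_poly k)"
proof -
  interpret zpoly_evaluation A "case_sum (lam0 a) (lam0 b)"
    using assms(1,2) by (rule zpoly_evaluation_lam0_sum)
  have "lam (a \<oplus> b) k = zpoly_eval A (case_sum (lam a) (lam b)) (add_poly k)"
    using ring_hom_add[OF lam_hom assms(1,2)] assms(3) by (simp add: witt_ring_def)
  also have "\<dots> = ev (add_poly k)"
    by (rule ev_cong) (use zvars_add_poly[OF assms(3)] in \<open>auto simp: lam0_eq split: sum.split\<close>)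
  finally show ?thesis .
qed

lemma lam_mult:
  assumes "a \<in> carrier A" "b \<in> carrier A" "k > 0"
  shows "lam (a \<otimes> b) k = zpoly_eval A (case_sum (lam0 a) (lam0 b)) (mult_poly k)"
proof -
  interpret zpoly_evaluation A "case_sum (lam0 a) (lam0 b)"
    using assms(1,2) by (rule zpoly_evaluation_lam0_sum)
  have "lam (a \<otimes> b) k = zpoly_eval A (case_sum (lam a) (lam b)) (mult_poly k)"
    using ring_hom_mult[OF lam_hom assms(1,2)] assms(3) by (simp add: witt_ring_def)
  also have "\<dots> = ev (mult_poly k)"
    by (rule ev_cong) (use zvars_mult_poly[OF assms(3)] in \<open>auto simp: lam0_eq split: sum.split\<close>)
  finally show ?thesis .
qed

lemma lam_lam:
  assumes "a \<in> carrier A" "e > 0" "k > 0"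
  shows "lam (lam a e) k = zpoly_eval A (lam0 a) (comult_poly e k)"
proof -
  interpret zpoly_evaluation A "lam0 a"
    using assms(1) by (rule zpoly_evaluation_lam0)
  have "lam (lam a e) k = zpoly_eval A (lam a) (comult_poly e k)"
    using coassoc[OF assms(1), THEN fun_cong, of e, THEN fun_cong, of k] assms(2,3)
    by (simp add: witt_map_def comult_def)
  also have "\<dots> = ev (comult_poly e k)"
    by (rule ev_cong) (use zvars_comult_poly[OF assms(2,3)] in \<open>auto simp: lam0_eq\<close>)
  finally show ?thesis .
qed

lemma lam_one: "a \<in> carrier A \<Longrightarrow> lam a 1 = a"
  using counit[of a] lam_closed[of a 1] by (simp add: ghost_def)

lemma ghost_lam0: "a \<in> carrier A \<Longrightarrow> n > 0 \<Longrightarrow> ghost A n (lam0 a) = adams A lam n a"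
  unfolding adams_def by (rule ghost_cong) (auto simp: lam0_eq lam_closed)

section \<open>Laws of the Adams operations\<close>

lemma adams_eq_ev:
  assumes "zpoly_evaluation A x" "n > 0" "\<And>k. k > 0 \<Longrightarrow> lam a k = zpoly_eval A x (c k)"
  shows "adams A lam n a = zpoly_eval A x (ghost_comp n c)"
proof -
  interpret zpoly_evaluation A x by fact
  show ?thesis
    unfolding adams_def ghost_ev[OF assms(2), symmetric]
    by (rule ghost_cong) (use assms in auto)
qed

lemma adams_hom:
  assumes "n > 0"
  shows "adams A lam n \<in> ring_hom A A"
proof (rule ring_hom_memI)
  fix a b assume ab: "a \<in> carrier A" "b \<in> carrier A"
  note eval = zpoly_evaluation_lam0_sum[OF ab]
  interpret zpoly_evaluation A "case_sum (lam0 a) (lam0 b)" by (rule eval)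
  have ab_ev: "adams A lam n a = ev (ghost_comp n (\<lambda>k. zpoly_var (Inl k)))"
      "adams A lam n b = ev (ghost_comp n (\<lambda>k. zpoly_var (Inr k)))"
    by (rule adams_eq_ev[OF eval assms]; simp add: lam0_eq)+
  then show "adams A lam n a \<in> carrier A" by simp
  have "adams A lam n (a \<oplus> b) = ev (ghost_comp n add_poly)"
    by (rule adams_eq_ev[OF eval assms]) (simp add: lam_add ab)
  then show "adams A lam n (a \<oplus> b) = adams A lam n a \<oplus> adams A lam n b"
    by (simp add: ghost_comp_add_poly assms ev_add ab_ev)
  have "adams A lam n (a \<otimes> b) = ev (ghost_comp n mult_poly)"
    by (rule adams_eq_ev[OF eval assms]) (simp add: lam_mult ab)
  then show "adams A lam n (a \<otimes> b) = adams A lam n a \<otimes> adams A lam n b"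
    by (simp add: ghost_comp_mult_poly assms ev_mult ab_ev)
next
  note eval = zpoly_evaluation_lam0[OF one_closed]
  interpret zpoly_evaluation A "lam0 \<one>" by (rule eval)
  have "adams A lam n \<one> = ev (ghost_comp n (\<lambda>k. if k = 1 then 1 else 0))"
    by (rule adams_eq_ev[OF eval assms])
      (simp add: ring_hom_one[OF lam_hom], simp add: witt_ring_def)
  then show "adams A lam n \<one> = \<one>"
    by (simp only: ghost_comp_unit[OF assms] ev_one)
qed

lemma adams_closed: "n > 0 \<Longrightarrow> a \<in> carrier A \<Longrightarrow> adams A lam n a \<in> carrier A"
  by (rule ring_hom_closed[OF adams_hom])

lemma adams_one: "a \<in> carrier A \<Longrightarrow> adams A lam 1 a = a"
  unfolding adams_def by (rule counit)

lemma adams_lam: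
  assumes "a \<in> carrier A" "e > 0" "m > 0"
  shows "adams A lam m (lam a e) = zpoly_eval A (lam0 a) (ghost_comp m (comult_poly e))"
  by (rule adams_eq_ev[OF zpoly_evaluation_lam0]) (simp_all add: assms lam_lam)

text \<open>The homomorphism \<open>adams A lam m\<close> moves inside the \<open>n\<close>-th ghost
  map. Coassociativity then turns its values at \<open>lam a e\<close> into ghost components of
  \<open>comult_poly e\<close>, and the double ghost identity applies.\<close>

lemma adams_adams:
  assumes "a \<in> carrier A" "m > 0" "n > 0"
  shows "adams A lam m (adams A lam n a) = adams A lam (m * n) a"
proof -
  interpret zpoly_evaluation A "lam0 a"
    using assms(1) by (rule zpoly_evaluation_lam0)
  interpret adams: ring_hom_cring A A "adams A lam m"
    by (intro ring_hom_cring.intro ring_hom_cring_axioms.intro is_cring adams_hom assms)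
  have "adams A lam m (adams A lam n a) = ghost A n (\<lambda>e. adams A lam m (lam a e))"
    unfolding adams_def[of A lam n] using assms by (intro adams.hom_ghost) (auto simp: lam_closed)
  also have "\<dots> = ghost A n (\<lambda>e. ev (ghost_comp m (comult_poly e)))"
    using assms by (intro ghost_cong) (auto simp: adams_lam)
  also have "\<dots> = ev (ghost_comp (m * n) zpoly_var)"
    using assms by (simp add: ghost_ev ghost_comp_ghost_comp_comult_poly)
  also have "\<dots> = ghost A (m * n) (lam0 a)"
    using assms ghost_ev[of "m * n" zpoly_var] by simp
  finally show ?thesis using assms by (simp add: ghost_lam0)
qed

end

section \<open>The operators \<open>D\<^sub>n\<close>\<close>

locale lambda_ring_derivation = lambda_ring A lam + derivation A M D
  for A :: "('a, 'b) ring_scheme" (structure) and lam and M :: "('a, 'c, 'd) module_scheme" (structure)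
    and D
begin

definition lam_D :: "nat \<Rightarrow> 'a \<Rightarrow> 'c" where
  "lam_D n a = ghost_deriv A M D n (lam a)"

lemma lam_D_closed: "n > 0 \<Longrightarrow> a \<in> carrier A \<Longrightarrow> lam_D n a \<in> carrier M"
  unfolding lam_D_def by (rule ghost_deriv_closed) (auto simp: lam_closed)

lemma lam_D_one:
  assumes "a \<in> carrier A"
  shows "lam_D 1 a = D a"
proof -
  have "{e :: nat. e dvd 1} = {1}" by auto
  then show ?thesis
    using lam_closed[OF assms, of 1] D_closed[OF assms] assms
    by (simp add: lam_D_def ghost_deriv_def lam_one[unfolded One_nat_def])
qed

lemma lam_D_eq_contract:
  assumes "zpoly_derivation A M D x V" "n > 0"
    and "\<And>k. k > 0 \<Longrightarrow> lam a k = zpoly_eval A x (c k)"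
    and "\<And>e. e dvd n \<Longrightarrow> zvars (c e) \<subseteq> V"
  shows "lam_D n a = zpoly_derivation.contract A M D x V (\<lambda>v. ghost_pd v n c)"
proof -
  interpret zpoly_derivation A M D x V by fact
  have "lam_D n a = ghost_deriv A M D n (\<lambda>k. ev (c k))"
    unfolding lam_D_def by (rule ghost_deriv_cong) (use assms in auto)
  also have "\<dots> = contract (\<lambda>v. ghost_pd v n c)"
    using assms by (intro ghost_deriv_ev)
  finally show ?thesis .
qed

text \<open>Specialized from \<open>ghost_pd_add_poly\<close> and \<open>ghost_pd_mult_poly\<close>.
  Thus \<open>D\<^sub>n\<close> is a derivation into \<open>M\<close> twisted by
  \<open>\<psi>\<^sub>n\<close>.\<close>

lemma derivation_lam_D:
  assumes "n > 0" "a \<in> carrier A" "b \<in> carrier A"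
  shows "lam_D n (a \<oplus> b) = lam_D n a \<oplus>\<^bsub>M\<^esub> lam_D n b"
    and "lam_D n (a \<otimes> b)
      = adams A lam n b \<odot>\<^bsub>M\<^esub> lam_D n a \<oplus>\<^bsub>M\<^esub> adams A lam n a \<odot>\<^bsub>M\<^esub> lam_D n b"
proof -
  define x where "x = case_sum (lam0 a) (lam0 b)"
  \<comment> \<open>All variables that occur at divisors of \<open>n\<close>, a finite set because
    \<open>n > 0\<close>.\<close>
  define V where "V = (\<Union>e\<in>{e. e dvd n}. zvars (add_poly e) \<union> zvars (mult_poly e) \<union> {Inl e, Inr e})"
  have x: "x (Inl k) = lam0 a k" "x (Inr k) = lam0 b k" for k by (simp_all add: x_def)
  have eval: "zpoly_evaluation A x"
    unfolding x_def using assms by (intro zpoly_evaluation_lam0_sum)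
  have deriv: "zpoly_derivation A M D x V"
    using eval assms(1)
    by (intro zpoly_derivation.intro derivation_axioms zpoly_derivation_axioms.intro)
      (simp_all add: V_def)
  interpret zpoly_derivation A M D x V by (rule deriv)
  have vars: "zvars (add_poly e) \<subseteq> V" "zvars (mult_poly e) \<subseteq> V" "Inl e \<in> V" "Inr e \<in> V"
    if "e dvd n" for e
    using that by (auto simp: V_def)
  have ab: "lam_D n a = contract (\<lambda>v. ghost_pd v n (\<lambda>k. zpoly_var (Inl k)))"
      "lam_D n b = contract (\<lambda>v. ghost_pd v n (\<lambda>k. zpoly_var (Inr k)))"
    by (rule lam_D_eq_contract[OF deriv assms(1)]; simp add: x lam0_eq vars)+
  have adams: "adams A lam n a = ev (ghost_comp n (\<lambda>k. zpoly_var (Inl k)))"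
      "adams A lam n b = ev (ghost_comp n (\<lambda>k. zpoly_var (Inr k)))"
    by (rule adams_eq_ev[OF eval assms(1)]; simp add: x lam0_eq)+
  have "lam_D n (a \<oplus> b) = contract (\<lambda>v. ghost_pd v n add_poly)"
    by (rule lam_D_eq_contract[OF deriv assms(1)]) (simp_all add: x_def lam_add assms vars)
  then show "lam_D n (a \<oplus> b) = lam_D n a \<oplus>\<^bsub>M\<^esub> lam_D n b"
    by (simp add: ghost_pd_add_poly assms(1) contract_add ab)
  have "lam_D n (a \<otimes> b) = contract (\<lambda>v. ghost_pd v n mult_poly)"
    by (rule lam_D_eq_contract[OF deriv assms(1)]) (simp_all add: x_def lam_mult assms vars)
  then show "lam_D n (a \<otimes> b)
      = adams A lam n b \<odot>\<^bsub>M\<^esub> lam_D n a \<oplus>\<^bsub>M\<^esub> adams A lam n a \<odot>\<^bsub>M\<^esub> lam_D n b"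
    by (simp add: ghost_pd_mult_poly assms(1) contract_add contract_mult ab adams)
qed

text \<open>Specialized from \<open>ghost_pd_comult_poly\<close>. The right side is what
  \<open>\<lambda>\<^sub>m\<close> will give on \<open>D\<^sub>n a\<close>, so this is the
  composition law on generators.\<close>

lemma lam_D_mult_index:
  assumes "m > 0" "n > 0" "a \<in> carrier A"
  shows "lam_D (m * n) a
    = (\<Oplus>\<^bsub>M\<^esub>e\<in>{e. e dvd n}. (adams A lam m (lam a e) [^] (n div e - 1)) \<odot>\<^bsub>M\<^esub> lam_D m (lam a e))"
proof -
  define V where "V = (\<Union>e\<in>{e. e dvd n}. \<Union>k\<in>{k. k dvd m}. zvars (comult_poly e k)) \<union> {e. e dvd m * n}"
  have eval: "zpoly_evaluation A (lam0 a)"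
    using assms by (intro zpoly_evaluation_lam0)
  have deriv: "zpoly_derivation A M D (lam0 a) V"
    using eval assms(1,2)
    by (intro zpoly_derivation.intro derivation_axioms zpoly_derivation_axioms.intro)
      (simp_all add: V_def)
  interpret zpoly_derivation A M D "lam0 a" V by (rule deriv)
  have "lam_D (m * n) a = contract (\<lambda>v. ghost_pd v (m * n) zpoly_var)"
    by (rule lam_D_eq_contract[OF deriv]) (use assms in \<open>auto simp: lam0_eq V_def\<close>)
  also have "\<dots> = contract (\<lambda>v. \<Sum>e | e dvd n.
      ghost_comp m (comult_poly e) ^ (n div e - 1) * ghost_pd v m (comult_poly e))"
    using assms by (simp only: ghost_pd_comult_poly)
  also have "\<dots> = (\<Oplus>\<^bsub>M\<^esub>e\<in>{e. e dvd n}. ev (ghost_comp m (comult_poly e) ^ (n div e - 1))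
      \<odot>\<^bsub>M\<^esub> contract (\<lambda>v. ghost_pd v m (comult_poly e)))"
    using assms by (intro contract_sum) simp
  also have "\<dots> = (\<Oplus>\<^bsub>M\<^esub>e\<in>{e. e dvd n}.
      (adams A lam m (lam a e) [^] (n div e - 1)) \<odot>\<^bsub>M\<^esub> lam_D m (lam a e))"
  proof (rule M.finsum_cong'[OF refl, symmetric])
    fix e assume e: "e \<in> {e. e dvd n}"
    then have "e > 0" using assms(2) by (auto intro: dvd_pos_nat)
    moreover from this have "lam_D m (lam a e) = contract (\<lambda>v. ghost_pd v m (comult_poly e))"
      by (intro lam_D_eq_contract[OF deriv]) (use assms e in \<open>auto simp: lam_lam V_def\<close>)
    ultimately show "adams A lam m (lam a e) [^] (n div e - 1) \<odot>\<^bsub>M\<^esub> lam_D m (lam a e)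
      = ev (ghost_comp m (comult_poly e) ^ (n div e - 1)) \<odot>\<^bsub>M\<^esub> contract (\<lambda>v. ghost_pd v m (comult_poly e))"
      using assms by (simp add: adams_lam ev_power)
  qed (auto intro!: smult_closed)
  finally show ?thesis .
qed

end

section \<open>Twisted modules and universal maps\<close>

text \<open>Maps semilinear along \<open>h\<close> become linear maps into the twisted module, where
  the universal property applies.\<close>

definition restrict_scalars :: "('a \<Rightarrow> 'a) \<Rightarrow> ('a, 'c, 'd) module_scheme \<Rightarrow> ('a, 'c, 'd) module_scheme"
where
  "restrict_scalars h M = M\<lparr>smult := \<lambda>a x. h a \<odot>\<^bsub>M\<^esub> x\<rparr>"

lemma restrict_scalars_simps [simp]:
  "carrier (restrict_scalars h M) = carrier M"
  "x \<oplus>\<^bsub>restrict_scalars h M\<^esub> y = x \<oplus>\<^bsub>M\<^esub> y"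
  "\<zero>\<^bsub>restrict_scalars h M\<^esub> = \<zero>\<^bsub>M\<^esub>"
  "a \<odot>\<^bsub>restrict_scalars h M\<^esub> x = h a \<odot>\<^bsub>M\<^esub> x"
  by (simp_all add: restrict_scalars_def)

lemma finsum_restrict_scalars: "finsum (restrict_scalars h M) f I = finsum M f I"
  by (simp add: finsum_def finprod_def restrict_scalars_def)

lemma (in module) module_restrict_scalars:
  assumes "h \<in> ring_hom R R"
  shows "module R (restrict_scalars h M)"
proof -
  have "abelian_group (restrict_scalars h M)"
    by (rule abelian_groupI)
      (auto simp: M.a_ac intro: bexI[of _ "\<ominus>\<^bsub>M\<^esub> x" for x] M.l_neg)
  then show ?thesis
    using assms ring_hom_closed[OF assms]
    by (intro moduleI R.is_cring)
      (simp_all add: smult_l_distr smult_r_distr smult_assoc1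
        ring_hom_add[OF assms] ring_hom_mult[OF assms] ring_hom_one[OF assms])
qed

lemma mod_homD:
  assumes "f \<in> mod_hom A M N"
  shows "x \<in> carrier M \<Longrightarrow> f x \<in> carrier N"
    and "x \<in> carrier M \<Longrightarrow> y \<in> carrier M \<Longrightarrow> f (x \<oplus>\<^bsub>M\<^esub> y) = f x \<oplus>\<^bsub>N\<^esub> f y"
    and "a \<in> carrier A \<Longrightarrow> x \<in> carrier M \<Longrightarrow> f (a \<odot>\<^bsub>M\<^esub> x) = a \<odot>\<^bsub>N\<^esub> f x"
  using assms by (auto simp: mod_hom_def)

lemma mod_hom_finsum:
  assumes "f \<in> mod_hom A M N" "abelian_group M" "abelian_group N" "finite I" "g \<in> I \<rightarrow> carrier M"
  shows "f (\<Oplus>\<^bsub>M\<^esub>i\<in>I. g i) = (\<Oplus>\<^bsub>N\<^esub>i\<in>I. f (g i))"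
proof -
  interpret M: abelian_group M by fact
  interpret N: abelian_group N by fact
  note f = mod_homD(1,2)[OF assms(1)]
  have "f \<zero>\<^bsub>M\<^esub> \<oplus>\<^bsub>N\<^esub> f \<zero>\<^bsub>M\<^esub> = f \<zero>\<^bsub>M\<^esub>"
    using f(2)[of "\<zero>\<^bsub>M\<^esub>" "\<zero>\<^bsub>M\<^esub>"] by simp
  then have "f \<zero>\<^bsub>M\<^esub> = \<zero>\<^bsub>N\<^esub>"
    using f(1)[of "\<zero>\<^bsub>M\<^esub>"] by (metis M.zero_closed N.add.r_cancel_one')
  with assms(4,5) show ?thesis
    by (induction rule: finite_induct) (simp_all add: Pi_iff f M.finsum_closed)
qed

lemma mod_hom_restrict:
  assumes "module A M"
    and "\<And>x. x \<in> carrier M \<Longrightarrow> f x \<in> carrier N"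
    and "\<And>x y. x \<in> carrier M \<Longrightarrow> y \<in> carrier M \<Longrightarrow> f (x \<oplus>\<^bsub>M\<^esub> y) = f x \<oplus>\<^bsub>N\<^esub> f y"
    and "\<And>a x. a \<in> carrier A \<Longrightarrow> x \<in> carrier M \<Longrightarrow> f (a \<odot>\<^bsub>M\<^esub> x) = a \<odot>\<^bsub>N\<^esub> f x"
  shows "restrict f (carrier M) \<in> mod_hom A M N"
proof -
  interpret module A M by fact
  show ?thesis using assms(2-) by (simp add: mod_hom_def)
qed

lemma derivation_mod_hom:
  assumes "derivation A \<Omega> d" "module A M" "f \<in> mod_hom A \<Omega> M"
  shows "derivation A M (\<lambda>a. f (d a))"
proof -
  interpret derivation A \<Omega> d by fact
  show ?thesis
    using assms(2)
    by (intro derivation.intro derivation_axioms.intro)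
      (simp_all add: D_closed D_add D_mult mod_homD[OF assms(3)])
qed

lemma universal_derivationD:
  fixes M :: "('a, 't) module"
  assumes "universal_derivation TYPE('t) A \<Omega> d"
  shows "derivation A \<Omega> d"
    and "derivation A M D \<Longrightarrow> \<exists>!f. f \<in> mod_hom A \<Omega> M \<and> (\<forall>a\<in>carrier A. f (d a) = D a)"
  by (rule assms[unfolded universal_derivation_def, THEN conjunct1])
    (rule assms[unfolded universal_derivation_def, THEN conjunct2, THEN spec, THEN spec, THEN mp])

text \<open>Uniqueness in the universal property for the derivation \<open>g\<close> after
  \<open>d\<close>. Equality of maps out of \<open>\<Omega>\<close> is hereby tested on the elements
  \<open>d a\<close>.\<close>

lemma universal_derivation_hom_eqI:
  fixes M :: "('a, 't) module"
  assumes "universal_derivation TYPE('t) A \<Omega> d" "module A M"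
    and "f \<in> mod_hom A \<Omega> M" "g \<in> mod_hom A \<Omega> M"
    and "\<And>a. a \<in> carrier A \<Longrightarrow> f (d a) = g (d a)"
  shows "f = g"
proof -
  have "derivation A M (\<lambda>a. g (d a))"
    by (rule derivation_mod_hom[OF universal_derivationD(1)[OF assms(1)] assms(2,4)])
  then have "\<exists>!h. h \<in> mod_hom A \<Omega> M \<and> (\<forall>a\<in>carrier A. h (d a) = g (d a))"
    by (rule universal_derivationD(2)[OF assms(1)])
  then show ?thesis using assms(3-) by blast
qed

section \<open>The \<lambda>-structure on Kaehler differentials\<close>

locale lambda_ring_universal_derivation = lambda_ring A lam
  for A :: "('a, 'b) ring_scheme" (structure) and lam +
  fixes \<Omega> :: "('a, 'm) module" and d :: "'a \<Rightarrow> 'm"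
  assumes universal: "universal_derivation TYPE('m) A \<Omega> d"

sublocale lambda_ring_universal_derivation \<subseteq> lambda_ring_derivation A lam \<Omega> d
  by (intro lambda_ring_derivation.intro lambda_ring_axioms universal_derivationD(1)[OF universal])

context lambda_ring_universal_derivation
begin

lemma ex_lambda_Omega:
  assumes "n > 0"
  shows "\<exists>f. f \<in> mod_hom A \<Omega> (restrict_scalars (adams A lam n) \<Omega>) \<and>
    (\<forall>a\<in>carrier A. f (d a) = lam_D n a)"
proof -
  have "derivation A (restrict_scalars (adams A lam n) \<Omega>) (lam_D n)"
    using assms module_restrict_scalars[OF adams_hom[OF assms]]
    by (intro derivation.intro derivation_axioms.intro)
      (simp_all add: lam_D_closed derivation_lam_D)
  from universal_derivationD(2)[OF universal this] show ?thesis by (rule ex1_implies_ex)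
qed

definition lambda_Omega :: "nat \<Rightarrow> 'm \<Rightarrow> 'm" where
  "lambda_Omega n = (SOME f. f \<in> mod_hom A \<Omega> (restrict_scalars (adams A lam n) \<Omega>) \<and>
    (\<forall>a\<in>carrier A. f (d a) = lam_D n a))"

lemma lambda_Omega_hom:
    "n > 0 \<Longrightarrow> lambda_Omega n \<in> mod_hom A \<Omega> (restrict_scalars (adams A lam n) \<Omega>)"
  and lambda_Omega_d: "n > 0 \<Longrightarrow> a \<in> carrier A \<Longrightarrow> lambda_Omega n (d a) = lam_D n a"
  using someI_ex[OF ex_lambda_Omega] unfolding lambda_Omega_def by auto

lemmas lambda_Omega_homD [simp] = mod_homD[OF lambda_Omega_hom, simplified]

lemma lambda_Omega_one:
  assumes "x \<in> carrier \<Omega>"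
  shows "lambda_Omega 1 x = x"
proof -
  have "lambda_Omega 1 = restrict (\<lambda>x. x) (carrier \<Omega>)"
  proof (rule universal_derivation_hom_eqI[OF universal module_axioms])
    have "lambda_Omega 1 \<in> mod_hom A \<Omega> (restrict_scalars (adams A lam 1) \<Omega>)"
      by (rule lambda_Omega_hom) simp
    \<comment> \<open>The twist is trivial here because \<open>\<psi>\<^sub>1\<close> is the
      identity on \<open>A\<close>.\<close>
    then show "lambda_Omega 1 \<in> mod_hom A \<Omega> \<Omega>"
      by (simp add: mod_hom_def adams_one[unfolded One_nat_def])
    show "restrict (\<lambda>x. x) (carrier \<Omega>) \<in> mod_hom A \<Omega> \<Omega>"
      by (rule mod_hom_restrict[OF module_axioms]) auto
    show "lambda_Omega 1 (d a) = restrict (\<lambda>x. x) (carrier \<Omega>) (d a)" if "a \<in> carrier A" for a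
      using that lambda_Omega_d[of 1 a] lam_D_one[of a] by (simp add: D_closed)
  qed
  then show ?thesis using assms by simp
qed

lemma lambda_Omega_finsum:
  assumes "finite I" "f \<in> I \<rightarrow> carrier \<Omega>" "m > 0"
  shows "lambda_Omega m (\<Oplus>\<^bsub>\<Omega>\<^esub>i\<in>I. f i) = (\<Oplus>\<^bsub>\<Omega>\<^esub>i\<in>I. lambda_Omega m (f i))"
proof -
  have "abelian_group (restrict_scalars (adams A lam m) \<Omega>)"
    using module_restrict_scalars[OF adams_hom[OF assms(3)]] by (simp add: module_def)
  from mod_hom_finsum[OF lambda_Omega_hom[OF assms(3)] M.abelian_group_axioms this assms(1,2)]
  show ?thesis by (simp add: finsum_restrict_scalars)
qed

text \<open>Both sides are semilinear along \<open>\<psi>\<^sub>m\<^sub>n\<close> by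
  \<open>adams_adams\<close>, and on \<open>d a\<close> they agree by
  \<open>lam_D_mult_index\<close>.\<close>

lemma lambda_Omega_lambda_Omega:
  assumes "m > 0" "n > 0" "x \<in> carrier \<Omega>"
  shows "lambda_Omega m (lambda_Omega n x) = lambda_Omega (m * n) x"
proof -
  let ?N = "restrict_scalars (adams A lam (m * n)) \<Omega>"
  have mn: "m * n > 0" using assms by simp
  have "restrict (\<lambda>x. lambda_Omega m (lambda_Omega n x)) (carrier \<Omega>) = lambda_Omega (m * n)"
  proof (rule universal_derivation_hom_eqI[OF universal module_restrict_scalars[OF adams_hom[OF mn]]])
    show "restrict (\<lambda>x. lambda_Omega m (lambda_Omega n x)) (carrier \<Omega>) \<in> mod_hom A \<Omega> ?N"
      by (rule mod_hom_restrict[OF module_axioms]) (simp_all add: assms adams_closed adams_adams)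
    show "lambda_Omega (m * n) \<in> mod_hom A \<Omega> ?N"
      using mn by (rule lambda_Omega_hom)
    fix a assume a: "a \<in> carrier A"
    have pos: "e > 0" if "e dvd n" for e
      using assms that by (auto intro: dvd_pos_nat)
    have "lambda_Omega m (lambda_Omega n (d a))
        = lambda_Omega m (\<Oplus>\<^bsub>\<Omega>\<^esub>e\<in>{e. e dvd n}. (lam a e [^] (n div e - 1)) \<odot>\<^bsub>\<Omega>\<^esub> d (lam a e))"
      using a assms by (simp add: lambda_Omega_d lam_D_def ghost_deriv_def)
    also have "\<dots> = (\<Oplus>\<^bsub>\<Omega>\<^esub>e\<in>{e. e dvd n}.
        lambda_Omega m ((lam a e [^] (n div e - 1)) \<odot>\<^bsub>\<Omega>\<^esub> d (lam a e)))"
      using a assms pos by (intro lambda_Omega_finsum) (auto simp: lam_closed D_closed)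
    also have "\<dots> = (\<Oplus>\<^bsub>\<Omega>\<^esub>e\<in>{e. e dvd n}.
        (adams A lam m (lam a e) [^] (n div e - 1)) \<odot>\<^bsub>\<Omega>\<^esub> lam_D m (lam a e))"
    proof (rule M.finsum_cong'[OF refl])
      interpret adams: ring_hom_cring A A "adams A lam m"
        by (intro ring_hom_cring.intro ring_hom_cring_axioms.intro is_cring adams_hom assms)
      show "lambda_Omega m ((lam a e [^] (n div e - 1)) \<odot>\<^bsub>\<Omega>\<^esub> d (lam a e))
          = (adams A lam m (lam a e) [^] (n div e - 1)) \<odot>\<^bsub>\<Omega>\<^esub> lam_D m (lam a e)"
        if "e \<in> {e. e dvd n}" for e
        using that a assms pos by (simp add: lam_closed D_closed adams.hom_pow lambda_Omega_d)
    qed (use a assms pos in \<open>auto intro!: smult_closed lam_D_closed simp: adams_closed lam_closed\<close>)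
    also have "\<dots> = lambda_Omega (m * n) (d a)"
      using a assms by (simp only: lambda_Omega_d mn lam_D_mult_index)
    finally show "restrict (\<lambda>x. lambda_Omega m (lambda_Omega n x)) (carrier \<Omega>) (d a) = lambda_Omega (m * n) (d a)"
      using a by (simp add: D_closed)
  qed
  from fun_cong[OF this, of x] show ?thesis using assms by simp
qed

lemma lambda_derivation_Omega: "lambda_derivation A lam \<Omega> lambda_Omega d"
proof -
  have "lambda_module A lam \<Omega> lambda_Omega"
    by (intro lambda_module.intro lambda_ring_axioms module_axioms lambda_module_axioms.intro)
      (simp_all add: lambda_Omega_one[unfolded One_nat_def] lambda_Omega_lambda_Omega)
  then show ?thesis
    by (intro lambda_derivation.intro derivation_axioms lambda_derivation_axioms.intro)
      (simp_all add: lambda_Omega_d lam_D_def ghost_deriv_def)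
qed

end

section \<open>Comparison of the universal derivations\<close>

lemma universal_lambda_derivationD:
  fixes M :: "('a, 't) module"
  assumes "universal_lambda_derivation TYPE('t) A lam \<Omega> lam\<Omega> d"
  shows "lambda_derivation A lam \<Omega> lam\<Omega> d"
    and "lambda_derivation A lam M lamM D \<Longrightarrow>
      \<exists>!f. f \<in> lambda_mod_hom A \<Omega> lam\<Omega> M lamM \<and> (\<forall>a\<in>carrier A. f (d a) = D a)"
  by (rule assms[unfolded universal_lambda_derivation_def, THEN conjunct1])
    (rule assms[unfolded universal_lambda_derivation_def, THEN conjunct2,
      THEN spec, THEN spec, THEN spec, THEN mp])

context lambda_ring_universal_derivation
begin

text \<open>Both composites are semilinear along \<open>\<psi>\<^sub>n\<close>. On
  \<open>d a\<close> they agree, since \<open>D\<close> satisfies in \<open>M\<close> the same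
  formula that defines \<open>lambda_Omega\<close> on \<open>d a\<close>.\<close>

lemma hom_commutes_lambda_Omega:
  fixes M :: "('a, 'm) module"
  assumes "lambda_derivation A lam M lamM D"
    and f: "f \<in> mod_hom A \<Omega> M" and fd: "\<And>a. a \<in> carrier A \<Longrightarrow> f (d a) = D a"
    and n: "n > 0" and x: "x \<in> carrier \<Omega>"
  shows "f (lambda_Omega n x) = lamM n (f x)"
proof -
  interpret N: lambda_derivation A lam M lamM D by fact
  note [simp] = mod_homD[OF f]
  let ?N = "restrict_scalars (adams A lam n) M"
  have pos: "e > 0" if "e dvd n" for e
    using n that by (auto intro: dvd_pos_nat)
  have "restrict (\<lambda>x. f (lambda_Omega n x)) (carrier \<Omega>) = restrict (\<lambda>x. lamM n (f x)) (carrier \<Omega>)"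
  proof (rule universal_derivation_hom_eqI[OF universal N.module_restrict_scalars[OF adams_hom[OF n]]])
    show "restrict (\<lambda>x. f (lambda_Omega n x)) (carrier \<Omega>) \<in> mod_hom A \<Omega> ?N"
      by (rule mod_hom_restrict[OF module_axioms]) (simp_all add: n adams_closed)
    show "restrict (\<lambda>x. lamM n (f x)) (carrier \<Omega>) \<in> mod_hom A \<Omega> ?N"
      by (rule mod_hom_restrict[OF module_axioms])
        (simp_all add: n N.lamM_closed N.lamM_add N.lamM_smult)
    fix a assume a: "a \<in> carrier A"
    have "f (lambda_Omega n (d a))
        = f (\<Oplus>\<^bsub>\<Omega>\<^esub>e\<in>{e. e dvd n}. (lam a e [^] (n div e - 1)) \<odot>\<^bsub>\<Omega>\<^esub> d (lam a e))"
      using a n by (simp add: lambda_Omega_d lam_D_def ghost_deriv_def)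
    also have "\<dots> = (\<Oplus>\<^bsub>M\<^esub>e\<in>{e. e dvd n}. f ((lam a e [^] (n div e - 1)) \<odot>\<^bsub>\<Omega>\<^esub> d (lam a e)))"
      using a n pos
      by (intro mod_hom_finsum[OF f] M.abelian_group_axioms N.M.abelian_group_axioms)
        (auto simp: lam_closed D_closed)
    also have "\<dots> = (\<Oplus>\<^bsub>M\<^esub>e\<in>{e. e dvd n}. (lam a e [^] (n div e - 1)) \<odot>\<^bsub>M\<^esub> D (lam a e))"
      using a pos by (intro N.M.finsum_cong') (auto simp: lam_closed D_closed N.D_closed fd)
    also have "\<dots> = lamM n (f (d a))"
      using a n by (simp add: fd N.lamM_D)
    finally show "restrict (\<lambda>x. f (lambda_Omega n x)) (carrier \<Omega>) (d a)
        = restrict (\<lambda>x. lamM n (f x)) (carrier \<Omega>) (d a)"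
      using a by (simp add: D_closed)
  qed
  from fun_cong[OF this, of x] show ?thesis using x by simp
qed

end

theorem theorem1:
  fixes A :: "('a, 'b) ring_scheme"
    and lam :: "'a \<Rightarrow> nat \<Rightarrow> 'a"
    and \<Omega> \<Omega>\<^sub>L :: "('a, 'm) module"
    and d d\<^sub>L :: "'a \<Rightarrow> 'm"
    and lamL :: "nat \<Rightarrow> 'm \<Rightarrow> 'm"
  assumes "lambda_ring A lam"
    and "universal_derivation TYPE('m) A \<Omega> d"
    and "universal_lambda_derivation TYPE('m) A lam \<Omega>\<^sub>L lamL d\<^sub>L"
  shows "(\<exists>!f. f \<in> mod_hom A \<Omega> \<Omega>\<^sub>L \<and> (\<forall>a\<in>carrier A. f (d a) = d\<^sub>L a)) \<and>
         (\<forall>f. f \<in> mod_hom A \<Omega> \<Omega>\<^sub>L \<and> (\<forall>a\<in>carrier A. f (d a) = d\<^sub>L a) \<longrightarrow>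
              f \<in> mod_iso A \<Omega> \<Omega>\<^sub>L)"
proof -
  interpret lambda_ring A lam by fact
  interpret lambda_ring_universal_derivation A lam \<Omega> d
    by (intro lambda_ring_universal_derivation.intro lambda_ring_universal_derivation_axioms.intro assms)
  have L: "lambda_derivation A lam \<Omega>\<^sub>L lamL d\<^sub>L"
    by (rule universal_lambda_derivationD(1)[OF assms(3)])
  interpret L: lambda_derivation A lam \<Omega>\<^sub>L lamL d\<^sub>L by (rule L)
  have "f \<in> mod_iso A \<Omega> \<Omega>\<^sub>L"
    if f: "f \<in> mod_hom A \<Omega> \<Omega>\<^sub>L" and fd: "\<And>a. a \<in> carrier A \<Longrightarrow> f (d a) = d\<^sub>L a" for f
  proof -
    \<comment> \<open>Universality of \<open>\<Omega>\<^sub>L\<close> applies to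
      \<open>\<Omega>\<close> because \<open>lambda_Omega\<close> makes \<open>d\<close> a
      \<lambda>-derivation.\<close>
    obtain g where g_lam: "g \<in> lambda_mod_hom A \<Omega>\<^sub>L lamL \<Omega> lambda_Omega"
      and gd: "\<And>a. a \<in> carrier A \<Longrightarrow> g (d\<^sub>L a) = d a"
      using universal_lambda_derivationD(2)[OF assms(3) lambda_derivation_Omega] by blast
    have g: "g \<in> mod_hom A \<Omega>\<^sub>L \<Omega>"
      and g_lamL: "\<And>n x. n > 0 \<Longrightarrow> x \<in> carrier \<Omega>\<^sub>L \<Longrightarrow> g (lamL n x) = lambda_Omega n (g x)"
      using g_lam by (auto simp: lambda_mod_hom_def)
    note f_simps = mod_homD[OF f] and g_simps = mod_homD[OF g]
    \<comment> \<open>Both maps fix every \<open>d a\<close>; the restrictions make them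
      extensional, as uniqueness requires.\<close>
    have "restrict (\<lambda>x. g (f x)) (carrier \<Omega>) = restrict (\<lambda>x. x) (carrier \<Omega>)"
    proof (rule universal_derivation_hom_eqI[OF universal module_axioms])
      show "restrict (\<lambda>x. g (f x)) (carrier \<Omega>) \<in> mod_hom A \<Omega> \<Omega>"
        by (rule mod_hom_restrict[OF module_axioms]) (simp_all add: f_simps g_simps)
      show "restrict (\<lambda>x. x) (carrier \<Omega>) \<in> mod_hom A \<Omega> \<Omega>"
        by (rule mod_hom_restrict[OF module_axioms]) simp_all
    qed (simp add: D_closed fd gd)
    from fun_cong[OF this] have gf: "g (f x) = x" if "x \<in> carrier \<Omega>" for x
      using that by (metis restrict_apply')
    \<comment> \<open>Uniqueness for \<open>\<Omega>\<^sub>L\<close> concerns only maps commuting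
      with the operations. Here \<open>g\<close> does so by construction and \<open>f\<close> by
      \<open>hom_commutes_lambda_Omega\<close>.\<close>
    have "restrict (\<lambda>x. f (g x)) (carrier \<Omega>\<^sub>L) \<in> lambda_mod_hom A \<Omega>\<^sub>L lamL \<Omega>\<^sub>L lamL"
      unfolding lambda_mod_hom_def
      by (auto intro!: mod_hom_restrict[OF L.module_axioms]
          simp: f_simps g_simps g_lamL L.lamM_closed hom_commutes_lambda_Omega[OF L f fd])
    moreover have "restrict (\<lambda>x. x) (carrier \<Omega>\<^sub>L) \<in> lambda_mod_hom A \<Omega>\<^sub>L lamL \<Omega>\<^sub>L lamL"
      unfolding lambda_mod_hom_def
      by (auto intro!: mod_hom_restrict[OF L.module_axioms] simp: L.lamM_closed)
    moreover have "restrict (\<lambda>x. f (g x)) (carrier \<Omega>\<^sub>L) (d\<^sub>L a) = d\<^sub>L a"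
      "restrict (\<lambda>x. x) (carrier \<Omega>\<^sub>L) (d\<^sub>L a) = d\<^sub>L a" if "a \<in> carrier A" for a
      using that by (simp_all add: L.D_closed fd gd)
    ultimately have "restrict (\<lambda>x. f (g x)) (carrier \<Omega>\<^sub>L) = restrict (\<lambda>x. x) (carrier \<Omega>\<^sub>L)"
      using universal_lambda_derivationD(2)[OF assms(3) L] by blast
    from fun_cong[OF this] have fg: "f (g x) = x" if "x \<in> carrier \<Omega>\<^sub>L" for x
      using that by (metis restrict_apply')
    have "bij_betw f (carrier \<Omega>) (carrier \<Omega>\<^sub>L)"
      by (rule bij_betwI[of _ _ _ g]) (auto simp: f_simps g_simps gf fg)
    with f show ?thesis by (simp add: mod_iso_def)
  qed
  then show ?thesis
    using universal_derivationD(2)[OF assms(2) L.derivation_axioms] by blast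
qed

end
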